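(* There exists a function $f\colon\mathbb{R}\to\mathbb{R}$ which is additive, almost continuous, and has the strong Cantor intermediate value property, but which is not extendable.
   Context: A Cantor set is any nonempty perfect nowhere dense subset of $\mathbb{R}$. A set is "between" two reals $p,q$ if it is contained in the open interval with endpoints $p$ and $q$ (empty if $p=q$). A function $f\colon\mathbb{R}\to\mathbb{R}$: - is additive if $f(x+y)=f(x)+f(y)$ for all $x,y\in\mathbb{R}$; - is almost continuous (in the sense of Stallings) if each open subset of $\mathbb{R}\times\mathbb{R}$ containing the graph of $f$ also contains the graph of a continuous function from $\mathbb{R}$ to $\mathbb{R}$; - has the strong Cantor intermediate value property (SCIVP) if for every $x,y\in\mathbb{R}$ and every Cantor set $K$ between $f(x)$ and $f(y)$ there is a Cantor set $C$ between $x$ and $y$ such that $f[C]\subset K$ and $f\restriction C$ is continuous; - is extendable if there exists a connectivity function $F\colon\mathbb{R}\times[0,1]\to\mathbb{R}$ with $f(x)=F(x,0)$ for every $x\in\mathbb{R}$. Here, for a topological space $X$, a function $F\colon X\to\mathbb{R}$ is a connectivity function if for every connected $Z\subset X$ the graph of $F\restriction Z$ is connected in $Z\times\mathbb{R}$. *)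

theory Defs
  imports "HOL-Analysis.Analysis"
begin

definition graph_on :: "('a \<Rightarrow> 'b) \<Rightarrow> 'a set \<Rightarrow> ('a \<times> 'b) set" where
  "graph_on f A = (\<lambda>x. (x, f x)) ` A"

definition perfect_set :: "'a::topological_space set \<Rightarrow> bool" where
  "perfect_set S \<longleftrightarrow> closed S \<and> (\<forall>x\<in>S. \<not> x isolated_in S)"

definition nowhere_dense :: "'a::topological_space set \<Rightarrow> bool" where
  "nowhere_dense S \<longleftrightarrow> interior (closure S) = {}"

definition cantor_set :: "real set \<Rightarrow> bool" where
  "cantor_set K \<longleftrightarrow> K \<noteq> {} \<and> perfect_set K \<and> nowhere_dense K"

definition almost_continuous :: "(real \<Rightarrow> real) \<Rightarrow> bool" where
  "almost_continuous f \<longleftrightarrow>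
     (\<forall>U. open U \<and> graph_on f UNIV \<subseteq> U \<longrightarrow>
        (\<exists>g :: real \<Rightarrow> real. continuous_on UNIV g \<and> graph_on g UNIV \<subseteq> U))"

text \<open>\<^term>\<open>open_segment p q\<close> is the open interval with endpoints \<^term>\<open>p\<close> and \<^term>\<open>q\<close>
  taken in either order; it is empty if they coincide.\<close>

definition scivp :: "(real \<Rightarrow> real) \<Rightarrow> bool" where
  "scivp f \<longleftrightarrow>
     (\<forall>x y K. cantor_set K \<and> K \<subseteq> open_segment (f x) (f y) \<longrightarrow>
        (\<exists>C. cantor_set C \<and> C \<subseteq> open_segment x y \<and> f ` C \<subseteq> K \<and> continuous_on C f))"

text \<open>A function on a subspace \<open>X\<close> is represented by a total function whose values
  outside \<open>X\<close> are irrelevant.\<close>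

definition connectivity_on :: "'a::topological_space set \<Rightarrow> ('a \<Rightarrow> real) \<Rightarrow> bool" where
  "connectivity_on X F \<longleftrightarrow> (\<forall>Z\<subseteq>X. connected Z \<longrightarrow> connected (graph_on F Z))"

definition extendable :: "(real \<Rightarrow> real) \<Rightarrow> bool" where
  "extendable f \<longleftrightarrow>
     (\<exists>F :: real \<times> real \<Rightarrow> real. connectivity_on (UNIV \<times> {0..1}) F \<and> (\<forall>x. f x = F (x, 0)))"

end

theory Submission
  imports Defs "HOL-Library.Nat_Bijection"
begin

text \<open>
  Let \<open>f\<close> extend to a connectivity function \<open>F\<close> and let \<open>f a < f b\<close>. For each \<open>y\<close> between these
  values some component of the level set \<open>F = y\<close> in the rectangle over \<open>[a, b]\<close> separates the two
  lower corners: otherwise, removing from the rectangle all level components together with the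
  regions they cut off leaves, by unicoherence, a connected set containing both corners on which
  \<open>F\<close> omits \<open>y\<close>. Each such component is a nondegenerate connected set touching the real line, and limits of
  nondegenerate connected subsets of level sets stay in level sets. With Baire's theorem the graph
  of \<open>f\<close> contains a closed set whose second projection contains an interval.

  Transfinite induction over the closed subsets of the plane yields an additive \<open>f\<close> whose graph
  contains no such set but meets every closed set whose first projection contains an
  interval, and which vanishes on a prescribed rational subspace of codimension continuum. The latter is chosen
  to contain a Cantor set, so translates of small multiples of this set are Cantor sets on which
  \<open>f\<close> is constant. This gives the strong Cantor intermediate value property.
\<close>

section \<open>Limits of connected subsets of level sets\<close>

text \<open>No continuity of \<open>F\<close> is available, and its level sets need not be closed.
  The substitute is that a connected graph with more than one point has no isolated point. Limits of
  level components are therefore under control only as long as they do not shrink to points. This is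
  why the two corners must be visible from every point along segments that meet nowhere else, and
  why level components over the line are sorted by a lower bound on their size.

  A closed set inside the graph is fatal for a generic additive function: the construction forces
  its first projection into a rational span on which \<open>f\<close> takes too few values to fill
  an interval, because the prescribed subspace contributes only the value 0. The codimension of that
  subspace has to be continuum since at no stage may it, together with fewer than continuum many
  chosen abscissae, span the reals.\<close>

lemma connectivity_on_closed_value:
  fixes F :: "'a::t1_space \<Rightarrow> real"
  assumes F: "connectivity_on X F" and Z: "Z \<subseteq> X" "connected Z" "q \<in> Z" "Z \<noteq> {q}"
    and N: "open N" "q \<in> N" and E: "closed E"
    and FE: "\<And>z. z \<in> Z \<Longrightarrow> z \<in> N \<Longrightarrow> z \<noteq> q \<Longrightarrow> F z \<in> E"
  shows "F q \<in> E"
proof (rule ccontr)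
  assume q: "F q \<notin> E"
  define G where "G = graph_on F Z"
  have conG: "connected G"
    using F Z by (simp add: connectivity_on_def G_def)
  \<comment> \<open>Over \<open>N\<close> the graph leaves \<open>E\<close> only at
    \<open>q\<close>, so \<open>(q, F q)\<close> would be an isolated point of the connected set
    \<open>G\<close>, which also has a point over another element of \<open>Z\<close>.\<close>
  have iso: "p = (q, F q)" if "p \<in> G" "p \<in> N \<times> (- E)" for p
    using that FE by (auto simp: G_def graph_on_def)
  obtain z where z: "z \<in> Z" "z \<noteq> q"
    using Z by blast
  have "(q, F q) \<in> (N \<times> (- E)) \<inter> G" "(z, F z) \<in> (- {(q, F q)}) \<inter> G"
    using q z Z N by (auto simp: G_def graph_on_def)
  moreover have "open (N \<times> (- E))" "open (- {(q, F q)})"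
    using N E by (auto intro: open_Times)
  moreover have "(N \<times> (- E)) \<inter> (- {(q, F q)}) \<inter> G = {}"
    using iso by auto
  moreover have "G \<subseteq> (N \<times> (- E)) \<union> (- {(q, F q)})"
    using q N by auto
  ultimately show False
    using connectedD[OF conG, of "N \<times> (- E)" "- {(q, F q)}"] by (metis empty_iff)
qed

lemma connectivity_on_connected_image:
  assumes "connectivity_on X F" "Z \<subseteq> X" "connected Z"
  shows "connected (F ` Z)"
proof -
  have "F ` Z = snd ` graph_on F Z"
    by (force simp: graph_on_def)
  moreover have "connected (snd ` graph_on F Z)"
    using assms by (intro connected_continuous_image continuous_intros) (auto simp: connectivity_on_def)
  ultimately show ?thesis by simp
qed

lemma connected_Union_atLeast:
  fixes C :: "nat \<Rightarrow> 'a::topological_space set"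
  assumes "\<And>i. connected (C i)" "\<And>i. C i \<inter> C (Suc i) \<noteq> {}"
  shows "connected (\<Union>i\<in>{n..}. C i)"
proof -
  have fin: "connected (\<Union>i\<in>{n..n+k}. C i)" for k
  proof (induction k)
    case (Suc k)
    have "(\<Union>i\<in>{n..n+Suc k}. C i) = (\<Union>i\<in>{n..n+k}. C i) \<union> C (Suc (n+k))"
      by (auto simp: atLeastAtMostSuc_conv)
    moreover have "(\<Union>i\<in>{n..n+k}. C i) \<inter> C (Suc (n+k)) \<noteq> {}"
      using assms(2)[of "n+k"] by fastforce
    ultimately show ?case
      using Suc assms(1) connected_Un by metis
  qed (use assms in auto)
  have "(\<Union>i\<in>{n..}. C i) = (\<Union>k. \<Union>i\<in>{n..n+k}. C i)"
  proof (intro equalityI subsetI)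
    fix x assume "x \<in> (\<Union>i\<in>{n..}. C i)"
    then obtain i where "x \<in> C (n + i)" by (auto dest: le_Suc_ex)
    then show "x \<in> (\<Union>k. \<Union>i\<in>{n..n+k}. C i)" by (intro UN_I[of i] UN_I[of "n+i"]) auto
  qed auto
  moreover obtain c where "c \<in> C n"
    using assms(2)[of n] by blast
  then have "c \<in> \<Inter> (range (\<lambda>k. \<Union>i\<in>{n..n+k}. C i))"
    by auto
  then have "connected (\<Union>k. \<Union>i\<in>{n..n+k}. C i)"
    using fin by (intro connected_Union) blast+
  ultimately show ?thesis by simp
qed

text \<open>Consecutive \<open>K i\<close> are joined by segments near \<open>a\<close>; the union is connected, and near \<open>b\<close> it
  consists of points of the \<open>K i\<close> only.\<close>

lemma connectivity_on_limit_value: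
  fixes F :: "'a::euclidean_space \<Rightarrow> real"
  assumes F: "connectivity_on X F" and X: "convex X" 
    and K: "\<And>i::nat. connected (K i)" "\<And>i. K i \<subseteq> X" "\<And>i. F ` K i \<subseteq> {y i}"
    and ab: "\<And>i. \<alpha> i \<in> K i" "\<And>i. \<beta> i \<in> K i" "\<alpha> \<longlonglongrightarrow> a" "\<beta> \<longlonglongrightarrow> b" "a \<noteq> b" "b \<in> X"
    and y: "y \<longlonglongrightarrow> l"
  shows "F b = l"
proof -
  have "dist (F b) l \<le> e" if e: "e > 0" for e
  proof -
    \<comment> \<open>Half the distance, so that the balls of radius \<open>d\<close> about
      \<open>a\<close> and \<open>b\<close> are disjoint; the joining segments stay in the
      first.\<close>
    define d where "d = dist a b / 2"
    have d: "d > 0" using ab by (simp add: d_def)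
    have "\<forall>\<^sub>F i in sequentially. dist (\<alpha> i) a < d" "\<forall>\<^sub>F i in sequentially. dist (y i) l < e"
      using ab y d e by (auto simp: tendsto_iff)
    then obtain n where n: "\<And>i. i \<ge> n \<Longrightarrow> dist (\<alpha> i) a < d" "\<And>i. i \<ge> n \<Longrightarrow> dist (y i) l < e"
      unfolding eventually_sequentially by (metis nat_le_linear order_trans)
    define C where "C i = K i \<union> closed_segment (\<alpha> i) (\<alpha> (Suc i))" for i
    have C: "connected (C i)" for i
      unfolding C_def using K ab(1)[of i] ends_in_segment(1)[of "\<alpha> i" "\<alpha> (Suc i)"]
    by (intro connected_Un connected_segment) auto
    have CC: "C i \<inter> C (Suc i) \<noteq> {}" for i
      unfolding C_def using ab(1)[of "Suc i"] ends_in_segment(2)[of "\<alpha> (Suc i)" "\<alpha> i"] by blast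
    have CX: "C i \<subseteq> X" for i
      unfolding C_def using K ab(1) X by (intro Un_least closed_segment_subset) blast+
    define T where "T = (\<Union>i\<in>{n..}. C i)"
    have T: "connected T" unfolding T_def by (intro connected_Union_atLeast C CC)
    have bT: "b \<in> closure T"
      unfolding closure_sequential
    proof (intro exI conjI allI)
      show "\<beta> (i + n) \<in> T" for i
        using ab by (force simp: T_def C_def)
      show "(\<lambda>i. \<beta> (i + n)) \<longlonglongrightarrow> b"
        using ab by (simp add: LIMSEQ_ignore_initial_segment)
    qed
    have "connected (insert b T)"
      by (rule connected_intermediate_closure[OF T]) (use bT closure_subset in auto)
    moreover have "insert b T \<subseteq> X"
      using CX ab by (auto simp: T_def)
    moreover have "insert b T \<noteq> {b}"
    proof -
      have "dist (\<alpha> n) a < d" using n by auto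
      then have "\<alpha> n \<noteq> b" using d by (auto simp: d_def dist_commute)
      moreover have "\<alpha> n \<in> T" using ab by (auto simp: T_def C_def)
      ultimately show ?thesis by auto
    qed
    moreover have "F z \<in> cball l e" if "z \<in> insert b T" "z \<in> ball b d" "z \<noteq> b" for z
    proof -
      obtain i where i: "i \<ge> n" "z \<in> C i" using \<open>z \<noteq> b\<close> \<open>z \<in> insert b T\<close> by (auto simp: T_def)
      have "closed_segment (\<alpha> i) (\<alpha> (Suc i)) \<subseteq> ball a d"
        using n(1)[of i] n(1)[of "Suc i"] i by (intro closed_segment_subset) (auto simp: dist_commute)
      moreover have "z \<notin> ball a d"
      proof
        assume "z \<in> ball a d"
        then have "dist a b < d + d"
          using \<open>z \<in> ball b d\<close> by (metis add_strict_mono dist_commute dist_triangle le_less_trans mem_ball)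
        then show False by (simp add: d_def)
      qed
      ultimately have "z \<in> K i" using i by (auto simp: C_def)
      then have "F z = y i" using K(3)[of i] by blast
      then show ?thesis using n(2)[of i] i by (auto simp: dist_commute)
    qed
    ultimately have "F b \<in> cball l e"
      using d by - (rule connectivity_on_closed_value[OF F, where Z = "insert b T" and N = "ball b d"], simp_all)
    then show ?thesis by (simp add: dist_commute)
  qed
  then have "dist (F b) l \<le> 0"
    by (rule field_le_epsilon) simp
  then show ?thesis by simp
qed

text \<open>The limit is the intersection of the closures of the tails of the chain, a nested
  sequence of compact connected sets. A point \<open>q \<noteq> a\<close> of it is a limit of points
  of the \<open>K i\<close> themselves, because the joining segments shrink to \<open>a\<close>. At
  \<open>a\<close> itself the value is obtained by exchanging the two sequences.\<close>

lemma connected_limit_in_level_set: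
  fixes F :: "'a::euclidean_space \<Rightarrow> real"
  assumes F: "connectivity_on X F" and X: "convex X" "compact X"
    and K: "\<And>i::nat. connected (K i)" "\<And>i. K i \<subseteq> X" "\<And>i. F ` K i \<subseteq> {y}"
    and ab: "\<And>i. \<alpha> i \<in> K i" "\<And>i. \<beta> i \<in> K i" "\<alpha> \<longlonglongrightarrow> a" "\<beta> \<longlonglongrightarrow> b" "a \<noteq> b"
  shows "\<exists>L. connected L \<and> L \<subseteq> X \<and> F ` L \<subseteq> {y} \<and> a \<in> L \<and> b \<in> L"
proof -
  have clX: "closed X" using X by (simp add: compact_imp_closed)
  have aX: "a \<in> X" and bX: "b \<in> X"
    using closed_sequentially[OF clX _ ab(3)] closed_sequentially[OF clX _ ab(4)] ab(1,2) K(2) by blast+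
  define C where "C i = K i \<union> closed_segment (\<alpha> i) (\<alpha> (Suc i))" for i
  have C: "connected (C i)" for i
    unfolding C_def using K ab(1)[of i] ends_in_segment(1)[of "\<alpha> i" "\<alpha> (Suc i)"]
    by (intro connected_Un connected_segment) auto
  have CC: "C i \<inter> C (Suc i) \<noteq> {}" for i
    unfolding C_def using ab(1)[of "Suc i"] ends_in_segment(2)[of "\<alpha> (Suc i)" "\<alpha> i"] by blast
  have CX: "C i \<subseteq> X" for i
    unfolding C_def using K ab(1) X by (intro Un_least closed_segment_subset) blast+
  define T where "T n = closure (\<Union>i\<in>{n..}. C i)" for n
  have TX: "T n \<subseteq> X" for n
    unfolding T_def by (intro closure_minimal clX) (use CX in blast)
  define L where "L = \<Inter> (range T)"
  have "connected L"
    unfolding L_def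
  proof (rule connected_nest)
    show "compact (T n)" for n
      by (metis TX T_def X(2) clX closed_Int_compact closed_closure inf.absorb_iff1)
    show "connected (T n)" for n
      unfolding T_def by (intro connected_imp_connected_closure connected_Union_atLeast C CC)
    show "T n \<subseteq> T m" if "m \<le> n" for m n
      unfolding T_def using that by (intro closure_mono UN_mono) auto
  qed
  moreover have "L \<subseteq> X"
    using TX by (auto simp: L_def)
  moreover have "c \<in> L" if "\<And>i. \<gamma> i \<in> K i" "\<gamma> \<longlonglongrightarrow> c" for \<gamma> c
  proof -
    have "c \<in> closure (\<Union>i\<in>{n..}. C i)" for n
      unfolding closure_sequential
    proof (intro exI conjI allI)
      show "\<gamma> (i + n) \<in> (\<Union>i\<in>{n..}. C i)" for i
        using that(1)[of "i + n"] by (intro UN_I[of "i + n"]) (auto simp: C_def)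
      show "(\<lambda>i. \<gamma> (i + n)) \<longlonglongrightarrow> c"
        using that by (simp add: LIMSEQ_ignore_initial_segment)
    qed
    then show ?thesis by (auto simp: L_def T_def)
  qed
  then have "a \<in> L" "b \<in> L"
    using ab by blast+
  moreover have "F q = y" if q: "q \<in> L" for q
  proof (cases "q = a")
    case True
    show ?thesis
      unfolding True
      by (rule connectivity_on_limit_value[OF F X(1) K(1-3) ab(2,1,4,3) _ aX]) (use ab in auto)
  next
    case False
    define d where "d = dist a q / 2"
    have d: "d > 0" using False by (simp add: d_def)
    have "\<forall>\<^sub>F i in sequentially. dist (\<alpha> i) a < d"
      using ab d by (auto simp: tendsto_iff)
    then obtain n where n: "\<And>i. i \<ge> n \<Longrightarrow> dist (\<alpha> i) a < d"
      unfolding eventually_sequentially by blast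
    have ex: "\<exists>i w. i \<ge> k \<and> w \<in> K i \<and> dist w q < inverse (Suc k)" for k
    proof -
      define e where "e = min d (inverse (Suc k))"
      have "e > 0" using d by (simp add: e_def)
      moreover have "q \<in> closure (\<Union>i\<in>{max n k..}. C i)"
        using q by (auto simp: L_def T_def)
      ultimately obtain w i where w: "i \<ge> max n k" "w \<in> C i" "dist w q < e"
        unfolding closure_approachable by blast
      have "closed_segment (\<alpha> i) (\<alpha> (Suc i)) \<subseteq> ball a d"
        using n[of i] n[of "Suc i"] w by (intro closed_segment_subset) (auto simp: dist_commute)
      moreover have "w \<notin> ball a d"
      proof
        assume "w \<in> ball a d"
        then have "dist a q < d + d"
          using w dist_triangle[of a q w] by (auto simp: e_def)
        then show False by (simp add: d_def)
      qed
      ultimately have "w \<in> K i" using w by (auto simp: C_def)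
      then show ?thesis using w by (auto simp: e_def)
    qed
    then obtain r w where rw: "\<And>k. r k \<ge> k" "\<And>k. w k \<in> K (r k)" "\<And>k. dist (w k) q < inverse (Suc k)"
      by metis
    have r: "filterlim r at_top sequentially"
      unfolding filterlim_at_top
      by (intro allI eventually_sequentiallyI) (rule order_trans[OF _ rw(1)])
    have wq: "w \<longlonglongrightarrow> q"
    proof (rule tendstoI)
      fix e :: real assume "e > 0"
      then obtain m where "inverse (Suc m) < e" using reals_Archimedean by blast
      moreover have "inverse (real (Suc k)) \<le> inverse (Suc m)" if "k \<ge> m" for k
        using that by (intro le_imp_inverse_le) auto
      ultimately have "dist (w k) q < e" if "k \<ge> m" for k
        using rw(3)[of k] that by (meson less_le_trans less_trans)
      then show "\<forall>\<^sub>F k in sequentially. dist (w k) q < e"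
        by (rule eventually_sequentiallyI)
    qed
    have "(\<lambda>k. \<alpha> (r k)) \<longlonglongrightarrow> a"
      using filterlim_compose[OF ab(3) r] .
    then show ?thesis
      using connectivity_on_limit_value[OF F X(1) K(1) K(2) K(3) ab(1) rw(2) _ wq _ _ tendsto_const]
        False \<open>L \<subseteq> X\<close> q by (metis subsetD)
  qed
  ultimately show ?thesis by blast
qed

section \<open>Separation by components of level sets\<close>

text \<open>As \<open>E\<close> is relatively open, a connected set avoiding
  \<open>closure E - E\<close> would be split by an open set cutting out \<open>E\<close> and the
  complement of \<open>closure E\<close>.\<close>

lemma connected_meets_relative_frontier:
  assumes "openin (top_of_set X) E" "connected R" "R \<subseteq> X" "R \<inter> E \<noteq> {}" "R - E \<noteq> {}"
  shows "R \<inter> (closure E - E) \<noteq> {}"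
proof
  assume no: "R \<inter> (closure E - E) = {}"
  obtain U where U: "open U" "E = X \<inter> U"
    using assms(1) by (auto simp: openin_open)
  have cl: "x \<in> closure E" if "x \<in> E" for x
    using that closure_subset by blast
  have "R \<subseteq> U \<union> (- closure E)" "U \<inter> (- closure E) \<inter> R = {}"
    using no U(2) assms(3) cl by auto
  then have "U \<inter> R = {} \<or> (- closure E) \<inter> R = {}"
    using connectedD[OF assms(2) U(1) open_Compl[OF closed_closure]] by blast
  then show False
    using no U(2) assms(4,5) by auto
qed

text \<open>The hypotheses negate separation, since no level component cuts \<open>b\<close> off
  from \<open>a\<close>; they will be shown to exclude \<open>F a < y < F b\<close>. The assumption
  \<open>corner\<close> prevents components that all meet both segments from a point
  \<open>x\<close> from shrinking to a point other than \<open>x\<close>.\<close>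

locale nonseparating_level_set =
  fixes X :: "'a::euclidean_space set" and F :: "'a \<Rightarrow> real" and y :: real and a b :: 'a
  assumes F: "connectivity_on X F" and X: "convex X" "compact X"
    and ab: "a \<in> X" "b \<in> X" "F a \<noteq> y" "F b \<noteq> y"
    and corner: "\<And>x. x \<in> X \<Longrightarrow> closed_segment x a \<inter> closed_segment x b \<subseteq> {x}"
    and nosep: "\<And>M. M \<in> components {x \<in> X. F x = y} \<Longrightarrow> b \<in> connected_component_set (X - M) a"
begin

section \<open>The regions cut off by level components\<close>

definition "D = {x \<in> X. F x = y}"

definition outer :: "'a set \<Rightarrow> 'a set" where
  "outer M = connected_component_set (X - M) a"

text \<open>For a level component \<open>M\<close> this is \<open>M\<close> together with every
  region of \<open>X - M\<close> that does not contain \<open>a\<close>; by \<open>nosep\<close> the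
  corner \<open>b\<close> is left out as well.\<close>

definition fill :: "'a set \<Rightarrow> 'a set" where
  "fill M = X - outer M"

lemma clX: "closed X"
  using X by (simp add: compact_imp_closed)

lemma connX: "connected X"
  using X by (simp add: convex_connected)

lemma segX: "x \<in> X \<Longrightarrow> z \<in> X \<Longrightarrow> closed_segment x z \<subseteq> X"
  using X by (simp add: closed_segment_subset)

lemma comp_sub: "M \<in> components D \<Longrightarrow> M \<subseteq> D" "M \<in> components D \<Longrightarrow> M \<subseteq> X"
  "M \<in> components D \<Longrightarrow> connected M" "M \<in> components D \<Longrightarrow> M \<noteq> {}"
  "M \<in> components D \<Longrightarrow> F ` M \<subseteq> {y}"
  using in_components_subset[of M D] in_components_connected[of M D] in_components_nonempty[of M D]
  by (auto simp: D_def)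

text \<open>Adding a limit point to a component keeps it connected, and the value at the new point
  is forced to be \<open>y\<close>, so maximality absorbs the point.\<close>

lemma comp_closed:
  assumes M: "M \<in> components D"
  shows "closed M"
proof -
  have "q \<in> M" if q: "q \<in> closure M" for q
  proof (rule ccontr)
    assume qM: "q \<notin> M"
    have conn: "connected (insert q M)"
      by (rule connected_intermediate_closure[OF comp_sub(3)[OF M]]) (use q closure_subset in auto)
    have qX: "q \<in> X"
      using q closure_minimal[OF comp_sub(2)[OF M] clX] by blast
    have "F q \<in> {y}"
    proof (rule connectivity_on_closed_value[OF F, where Z = "insert q M" and N = UNIV])
      show "insert q M \<noteq> {q}" using comp_sub(4)[OF M] qM by blast
      show "F z \<in> {y}" if "z \<in> insert q M" "z \<noteq> q" for z
        using that comp_sub(5)[OF M] by blast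
    qed (use qX comp_sub(2)[OF M] conn in auto)
    then have "insert q M \<subseteq> D"
      using qX comp_sub(1)[OF M] by (auto simp: D_def)
    moreover have "M \<inter> insert q M \<noteq> {}" using comp_sub(4)[OF M] by blast
    ultimately show False
      using components_maximal[OF M conn] qM by blast
  qed
  then show ?thesis
    by (metis closure_subset_eq subsetI)
qed

lemma outer_sub: "outer M \<subseteq> X - M"
  by (simp add: outer_def connected_component_subset)

lemma outer_connected: "connected (outer M)"
  by (simp add: outer_def)

lemma locally_pc:
  assumes M: "M \<in> components D"
  shows "locally path_connected (X - M)" "openin (top_of_set X) (X - M)"
proof -
  show op: "openin (top_of_set X) (X - M)"
    using comp_closed[OF M] by (metis openin_diff openin_subtopology_self closed_subset comp_sub(2)[OF M])
  show "locally path_connected (X - M)"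
    using convex_imp_locally_path_connected[OF X(1)] op locally_open_subset by blast
qed

lemma a_outer: "M \<in> components D \<Longrightarrow> a \<in> outer M"
  using ab comp_sub(1)[of M] by (auto simp: outer_def D_def)

lemma b_outer: "M \<in> components D \<Longrightarrow> b \<in> outer M"
  using nosep by (simp add: outer_def D_def)

lemma sub_fill: "M \<in> components D \<Longrightarrow> M \<subseteq> fill M"
  using outer_sub comp_sub(2) by (auto simp: fill_def)

lemma outer_absorb:
  assumes "connected R" "R \<subseteq> X" "R \<inter> M = {}" "R \<inter> outer M \<noteq> {}"
  shows "R \<subseteq> outer M"
proof -
  obtain z where z: "z \<in> R" "z \<in> outer M" using assms by blast
  then have "R \<subseteq> connected_component_set (X - M) z"
    using assms by (intro connected_component_maximal) auto
  then show ?thesis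
    using connected_component_eq[of z "X - M" a] z by (simp add: outer_def)
qed

lemma fill_connected:
  assumes M: "M \<in> components D"
  shows "connected (fill M)"
  unfolding fill_def
proof (rule component_diff_connected[OF comp_sub(3)[OF M] connX comp_sub(2)[OF M]])
  show "outer M \<in> components (X - M)"
    using a_outer[OF M] outer_sub by (auto simp: outer_def components_def)
qed

lemma comp_disjoint: "M \<in> components D \<Longrightarrow> N \<in> components D \<Longrightarrow> M \<noteq> N \<Longrightarrow> M \<inter> N = {}"
  by (simp add: components_nonoverlap)

text \<open>A component not contained in \<open>outer N\<close> misses it entirely, being connected
  and disjoint from \<open>N\<close>. So \<open>outer N\<close> is a connected set through
  \<open>a\<close> that avoids \<open>M\<close>.\<close>

lemma fill_mono:
  assumes M: "M \<in> components D" and N: "N \<in> components D" and MN: "M \<noteq> N" "\<not> M \<subseteq> outer N"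
  shows "fill M \<subseteq> fill N"
proof -
  have "M \<inter> outer N = {}"
    using outer_absorb[OF comp_sub(3)[OF M] comp_sub(2)[OF M] comp_disjoint[OF M N MN(1)]] MN(2) by blast
  then have "outer N \<subseteq> outer M"
    using outer_sub[of N] a_outer[OF M] a_outer[OF N] by (intro outer_absorb outer_connected) auto
  then show ?thesis by (auto simp: fill_def)
qed

lemma fill_disjoint:
  assumes M: "M \<in> components D" and N: "N \<in> components D" and MN: "M \<subseteq> outer N" "N \<subseteq> outer M"
  shows "fill M \<inter> fill N = {}"
proof -
  have "fill M \<subseteq> outer N"
  proof (rule outer_absorb[OF fill_connected[OF M]])
    show "fill M \<subseteq> X" "fill M \<inter> N = {}" using MN by (auto simp: fill_def)
    show "fill M \<inter> outer N \<noteq> {}" using MN comp_sub(4)[OF M] sub_fill[OF M] by blast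
  qed
  then show ?thesis by (auto simp: fill_def)
qed

lemma fill_laminar:
  assumes M: "M \<in> components D" and N: "N \<in> components D" and x: "x \<in> fill M" "x \<in> fill N"
  shows "fill M \<subseteq> fill N \<or> fill N \<subseteq> fill M"
  using fill_mono[OF M N] fill_mono[OF N M] fill_disjoint[OF M N] x by blast

lemma segment_meets:
  assumes "x \<in> fill M" "z \<in> outer M"
  shows "closed_segment x z \<inter> M \<noteq> {}"
proof
  assume "closed_segment x z \<inter> M = {}"
  moreover have "x \<in> X" "z \<in> X" using assms outer_sub[of M] by (auto simp: fill_def)
  ultimately have "closed_segment x z \<subseteq> outer M"
    using assms(2) ends_in_segment(2)[of z x] by (intro outer_absorb segX) auto
  then show False using assms(1) ends_in_segment(1)[of x z] by (auto simp: fill_def)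
qed

text \<open>If \<open>p \<noteq> q\<close>, a connected limit joins them inside the level set, so
  they share a component.\<close>

lemma limit_component:
  assumes M: "\<And>i::nat. M i \<in> components D" and zw: "\<And>i. z i \<in> M i" "\<And>i. w i \<in> M i"
    and lim: "z \<longlonglongrightarrow> p" "w \<longlonglongrightarrow> q" and N: "N \<in> components D" "p \<in> N"
  shows "q \<in> N"
proof (cases "p = q")
  case False
  then obtain L where "connected L" "L \<subseteq> X" "F ` L \<subseteq> {y}" "p \<in> L" "q \<in> L"
    using connected_limit_in_level_set[OF F X comp_sub(3)[OF M] comp_sub(2)[OF M] comp_sub(5)[OF M] zw lim]
    by blast
  then show ?thesis
    using components_maximal[OF N(1), of L] N(2) by (auto simp: D_def)
qed (use N in simp)

end

lemma dist_less_of_mem_closed_segment: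
  fixes z :: "'a::real_normed_vector"
  assumes "w \<in> closed_segment z a" "w \<noteq> z"
  shows "dist w a < dist z a"
proof -
  obtain u where u: "0 \<le> u" "u \<le> 1" "w = (1 - u) *\<^sub>R z + u *\<^sub>R a"
    using assms by (auto simp: closed_segment_def)
  then have "u \<noteq> 0" and za: "z \<noteq> a"
    using assms by (auto simp: algebra_simps)
  have "w - a = (1 - u) *\<^sub>R (z - a)"
    using u by (simp add: algebra_simps)
  then have "dist w a = (1 - u) * dist z a"
    using u by (simp add: dist_norm)
  then show ?thesis
    using u \<open>u \<noteq> 0\<close> za by (simp add: mult_less_cancel_right1)
qed

section \<open>Maximal fills and the connectedness of what lies outside them\<close>

context nonseparating_level_set
begin

text \<open>A larger fill has a component meeting the segment from \<open>x\<close> to \<open>a\<close> closer to \<open>a\<close>. A minimizing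
  sequence of components also meets the segment from \<open>x\<close> to \<open>b\<close>, so it cannot shrink to a point.\<close>

lemma maximal_fill:
  assumes M0: "M0 \<in> components D" and x: "x \<in> fill M0"
  shows "\<exists>M\<in>components D. x \<in> fill M \<and> (\<forall>N\<in>components D. x \<in> fill N \<longrightarrow> fill N \<subseteq> fill M)"
proof -
  define \<F> where "\<F> = {M \<in> components D. x \<in> fill M}"
  \<comment> \<open>The distances to \<open>a\<close> at which components with \<open>x\<close> in
    their fill meet the segment; a component attaining the infimum will have the largest
    fill.\<close>
  define Ds where "Ds = {dist z a |z M. M \<in> \<F> \<and> z \<in> M \<inter> closed_segment x a}"
  define d where "d = Inf Ds"
  have xX: "x \<in> X" using x by (auto simp: fill_def)
  have meet_a: "closed_segment x a \<inter> M \<noteq> {}" and meet_b: "closed_segment x b \<inter> M \<noteq> {}" if "M \<in> \<F>" for M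
    using that segment_meets[of x M] a_outer b_outer by (auto simp: \<F>_def)
  have M0F: "M0 \<in> \<F>" using M0 x by (simp add: \<F>_def)
  have bdd: "bdd_below Ds"
    unfolding Ds_def by (rule bdd_belowI[of _ 0]) auto
  have ne: "Ds \<noteq> {}"
    using meet_a[OF M0F] M0F unfolding Ds_def by blast
  have low: "d \<le> dist z a" if "M \<in> \<F>" "z \<in> M" "z \<in> closed_segment x a" for M z
    unfolding d_def by (rule cInf_lower[OF _ bdd]) (use that in \<open>auto simp: Ds_def\<close>)
  have "\<exists>M\<in>\<F>. \<exists>z\<in>M. z \<in> closed_segment x a \<and> dist z a = d"
  proof -
    have "\<exists>M z. M \<in> \<F> \<and> z \<in> M \<and> z \<in> closed_segment x a \<and> dist z a < d + inverse (Suc n)" for n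
    proof -
      have "Inf Ds < d + inverse (Suc n)" by (simp add: d_def)
      then obtain t where "t \<in> Ds" "t < d + inverse (Suc n)"
        using cInf_less_iff[OF ne bdd] by blast
      then show ?thesis by (auto simp: Ds_def)
    qed
    then obtain M z where Mz: "\<And>n. M n \<in> \<F>" "\<And>n. z n \<in> M n" "\<And>n. z n \<in> closed_segment x a"
        "\<And>n. dist (z n) a < d + inverse (Suc n)"
      by metis
    have "\<exists>w. w \<in> M n \<and> w \<in> closed_segment x b" for n
      using meet_b[OF Mz(1)] by blast
    then obtain w where w: "\<And>n. w n \<in> M n" "\<And>n. w n \<in> closed_segment x b"
      by metis
    have Mc: "M n \<in> components D" for n
      using Mz(1) by (simp add: \<F>_def)
    obtain p r1 where r1: "strict_mono r1" "p \<in> closed_segment x a" "(z \<circ> r1) \<longlonglongrightarrow> p"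
      using Mz(3) compact_segment[of x a] unfolding compact_def by metis
    obtain q r2 where r2: "strict_mono r2" "q \<in> closed_segment x b" "((w \<circ> r1) \<circ> r2) \<longlonglongrightarrow> q"
      using w(2) compact_segment[of x b] unfolding compact_def by (metis comp_apply)
    define r where "r = r1 \<circ> r2"
    have r: "strict_mono r" unfolding r_def using r1 r2 strict_mono_o by blast
    have zr: "(\<lambda>n. z (r n)) \<longlonglongrightarrow> p"
      using LIMSEQ_subseq_LIMSEQ[OF r1(3) r2(1)] by (simp add: r_def o_def)
    have wr: "(\<lambda>n. w (r n)) \<longlonglongrightarrow> q"
      using r2(3) by (simp add: r_def o_def)
    have "dist p a \<le> d"
    proof (rule LIMSEQ_le)
      show "(\<lambda>n. dist (z (r n)) a) \<longlonglongrightarrow> dist p a"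
        by (intro tendsto_intros zr)
      have "(\<lambda>n. d + inverse (real (Suc n))) \<longlonglongrightarrow> d + 0"
        by (intro tendsto_intros LIMSEQ_inverse_real_of_nat)
      then show "(\<lambda>n. d + inverse (real (Suc (r n)))) \<longlonglongrightarrow> d"
        using LIMSEQ_subseq_LIMSEQ[OF _ r] by (fastforce simp: o_def)
      show "\<exists>N. \<forall>n\<ge>N. dist (z (r n)) a \<le> d + inverse (real (Suc (r n)))"
        using Mz(4) less_imp_le by blast
    qed
    moreover have "d \<le> dist p a"
    proof (rule LIMSEQ_le_const)
      show "(\<lambda>n. dist (z (r n)) a) \<longlonglongrightarrow> dist p a"
        by (intro tendsto_intros zr)
      show "\<exists>N. \<forall>n\<ge>N. d \<le> dist (z (r n)) a"
        using low[OF Mz(1-3)] by blast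
    qed
    ultimately have pd: "dist p a = d" by simp
    show ?thesis
    proof (cases "p = q")
      \<comment> \<open>Then \<open>p = x\<close> by \<open>corner\<close>, so \<open>d\<close> is
        the largest distance to \<open>a\<close> on the segment and already \<open>z 0\<close>
        attains it.\<close>
      case True
      then have "p = x" using corner[OF xX] r1(2) r2(2) by blast
      have "dist (z 0) a \<le> dist x a"
        using dist_less_of_mem_closed_segment[OF Mz(3)[of 0]] by (cases "z 0 = x") auto
      then have "dist (z 0) a = d"
        using low[OF Mz(1-3), of 0] pd \<open>p = x\<close> by simp
      then show ?thesis using Mz by blast
    next
      case False
      obtain L where L: "connected L" "L \<subseteq> X" "F ` L \<subseteq> {y}" "p \<in> L" "q \<in> L"
        using connected_limit_in_level_set[OF F X comp_sub(3)[OF Mc] comp_sub(2)[OF Mc] comp_sub(5)[OF Mc]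
            Mz(2) w(1) zr wr False] by blast
      define P where "P = connected_component_set D p"
      have pD: "p \<in> D" using L by (auto simp: D_def)
      then have P: "P \<in> components D" "p \<in> P"
        by (auto simp: P_def components_def)
      \<comment> \<open>Otherwise a path from \<open>a\<close> to \<open>x\<close> avoids
        \<open>P\<close>. Each \<open>M (r n)\<close> has \<open>x\<close> in its fill and so meets
        the path; a limit of meeting points stays on the compact path and lies in \<open>P\<close>
        by \<open>limit_component\<close>.\<close>
      have "x \<in> fill P"
      proof (rule ccontr)
        assume "x \<notin> fill P"
        then have xo: "x \<in> outer P" using xX by (simp add: fill_def)
        have "path_component (X - P) a x"
          using xo path_component_eq_connected_component_set[OF locally_pc(1)[OF P(1)], of a]
          by (auto simp: outer_def)
        then obtain g where g: "path g" "path_image g \<subseteq> X - P" "pathstart g = a" "pathfinish g = x"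
          by (auto simp: path_component_def)
        define R where "R = path_image g"
        have R: "connected R" "compact R" "R \<subseteq> X - P" "a \<in> R" "x \<in> R"
          using g by (auto simp: R_def connected_path_image compact_path_image)
        have "\<exists>v. v \<in> M (r n) \<and> v \<in> R" for n
        proof (rule ccontr)
          assume "\<nexists>v. v \<in> M (r n) \<and> v \<in> R"
          then have "R \<subseteq> outer (M (r n))"
            using R a_outer[OF Mc, of "r n"] by (intro outer_absorb) auto
          then show False
            using R(5) Mz(1)[of "r n"] by (auto simp: \<F>_def fill_def)
        qed
        then obtain v where v: "\<And>n. v n \<in> M (r n)" "\<And>n. v n \<in> R"
          by metis
        obtain s r3 where s: "strict_mono r3" "s \<in> R" "(v \<circ> r3) \<longlonglongrightarrow> s"
          using v(2) R(2) unfolding compact_def by metis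
        have "(\<lambda>n. z (r (r3 n))) \<longlonglongrightarrow> p"
          using LIMSEQ_subseq_LIMSEQ[OF zr s(1)] by (simp add: o_def)
        moreover have "(\<lambda>n. v (r3 n)) \<longlonglongrightarrow> s"
          using s(3) by (simp add: o_def)
        ultimately have "s \<in> P"
          using limit_component[of "\<lambda>n. M (r (r3 n))" "\<lambda>n. z (r (r3 n))" "\<lambda>n. v (r3 n)" p s P]
            Mc Mz(2) v(1) P by blast
        then show False using s(2) R(3) by blast
      qed
      then have "P \<in> \<F>" using P by (simp add: \<F>_def)
      then show ?thesis using P r1(2) pd by blast
    qed
  qed
  then obtain M z where M: "M \<in> \<F>" and z: "z \<in> M" "z \<in> closed_segment x a" "dist z a = d"
    by blast
  have "fill N \<subseteq> fill M" if N: "N \<in> \<F>" for N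
  proof (rule ccontr)
    assume no: "\<not> fill N \<subseteq> fill M"
    then have "N \<noteq> M" by blast
    have "fill M \<subseteq> fill N"
      using fill_laminar[of M N x] M N no by (auto simp: \<F>_def)
    then have "z \<in> fill N" using z sub_fill M by (auto simp: \<F>_def)
    then obtain w where w: "w \<in> closed_segment z a" "w \<in> N"
      using segment_meets[of z N a] a_outer N by (auto simp: \<F>_def)
    have "M \<inter> N = {}" using comp_disjoint[of M N] M N \<open>N \<noteq> M\<close> by (auto simp: \<F>_def)
    then have "w \<noteq> z" using z(1) w(2) by blast
    then have "dist w a < d" using dist_less_of_mem_closed_segment[OF w(1)] z(3) by simp
    moreover have "w \<in> closed_segment x a"
      using w(1) z(2) subset_closed_segment[of z a x a] by auto
    ultimately show False using low[OF N w(2)] by simp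
  qed
  then show ?thesis using M by (auto simp: \<F>_def)
qed

text \<open>The union avoids a choice; by \<open>maximal_fill\<close> it is itself a fill whenever
  \<open>x\<close> lies in one.\<close>

definition max_fill :: "'a \<Rightarrow> 'a set" where
  "max_fill x = \<Union> {fill N |N. N \<in> components D \<and> x \<in> fill N}"

text \<open>Chosen from \<^term>\<open>max_fill x\<close> alone, so points with the same maximal fill get the same component.\<close>

definition max_comp :: "'a \<Rightarrow> 'a set" where
  "max_comp x = (SOME M. M \<in> components D \<and> fill M = max_fill x)"

lemma max_comp:
  assumes "N \<in> components D" "x \<in> fill N"
  shows "max_comp x \<in> components D" "fill (max_comp x) = max_fill x" "x \<in> max_fill x"
proof -
  obtain M where M: "M \<in> components D" "x \<in> fill M"
      "\<And>N. N \<in> components D \<Longrightarrow> x \<in> fill N \<Longrightarrow> fill N \<subseteq> fill M"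
    using maximal_fill[OF assms] by blast
  have eq: "max_fill x = fill M"
    using M unfolding max_fill_def by blast
  have "max_comp x \<in> components D \<and> fill (max_comp x) = max_fill x"
    unfolding max_comp_def by (rule someI[of _ M]) (use M eq in simp)
  then show "max_comp x \<in> components D" "fill (max_comp x) = max_fill x" "x \<in> max_fill x"
    using eq M by auto
qed

lemma max_comp_eq:
  assumes "N \<in> components D" "x \<in> fill N" and z: "z \<in> max_fill x"
  shows "max_comp z = max_comp x"
proof -
  note mx = max_comp[OF assms(1,2)]
  have zx: "z \<in> fill (max_comp x)" using mx z by simp
  note mz = max_comp[OF mx(1) zx]
  have "fill (max_comp x) \<subseteq> max_fill z"
    using mx(1) zx unfolding max_fill_def by blast
  then have "x \<in> fill (max_comp z)" using mx mz by auto
  then have "fill (max_comp z) \<subseteq> max_fill x"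
    using mz(1) unfolding max_fill_def by blast
  then have "max_fill z = max_fill x"
    using \<open>fill (max_comp x) \<subseteq> max_fill z\<close> mx(2) mz(2) by blast
  then show ?thesis by (simp add: max_comp_def)
qed

text \<open>The union of the maximal components over \<open>J\<close> inherits connectedness from \<open>J\<close>, so it is one component.\<close>

lemma connected_subset_fill:
  assumes J: "connected J" "J \<noteq> {}" "J \<subseteq> \<Union> (fill ` components D)"
  shows "\<exists>M\<in>components D. J \<subseteq> fill M"
proof -
  have mJ: "max_comp x \<in> components D" "fill (max_comp x) = max_fill x" "x \<in> max_fill x" if "x \<in> J" for x
    using that J(3) max_comp by blast+
  have eqJ: "max_comp z = max_comp x" if "x \<in> J" "z \<in> fill (max_comp x)" for x z
    using that J(3) mJ max_comp_eq by blast
  have xin: "x \<in> fill (max_comp x)" if "x \<in> J" for x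
    using mJ that by blast
  have JX: "J \<subseteq> X" using J(3) by (auto simp: fill_def)
  define T where "T = (\<Union>x\<in>J. max_comp x)"
  \<comment> \<open>\<open>max_comp\<close> need not be locally constant on \<open>J\<close>, but if
    it lies in \<open>A\<close> at \<open>x\<close>, then it meets \<open>A\<close> at nearby
    points. If \<open>x\<close> is on its component, a nearby component either is the same or
    crosses the short segment to \<open>x\<close>, which lies in \<open>A\<close>. If not, the
    points of \<open>J\<close> near \<open>x\<close> lie in the same fill.\<close>
  have loc: "\<exists>e>0. \<forall>x'\<in>J \<inter> ball x e. max_comp x' \<inter> A \<noteq> {}"
    if x: "x \<in> J" "max_comp x \<inter> A \<noteq> {}" and A: "open A" "max_comp x \<subseteq> A" for A x
  proof (cases "x \<in> max_comp x")
    case True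
    then obtain e where e: "e > 0" "ball x e \<subseteq> A"
      using A open_contains_ball by blast
    have "max_comp x' \<inter> A \<noteq> {}" if x': "x' \<in> J" "x' \<in> ball x e" for x'
    proof (cases "x \<in> fill (max_comp x')")
      case True
      then show ?thesis using eqJ[OF x'(1)] x by metis
    next
      case False
      then have "x \<in> outer (max_comp x')" using x JX by (auto simp: fill_def)
      then have "closed_segment x' x \<inter> max_comp x' \<noteq> {}"
        using segment_meets[OF xin[OF x'(1)]] by blast
      moreover have "closed_segment x' x \<subseteq> ball x e"
        using x' e by (intro closed_segment_subset) auto
      ultimately show ?thesis using e by blast
    qed
    then show ?thesis using e by blast
  next
    case False
    have "open (- max_comp x)" using comp_closed[OF mJ(1)[OF x(1)]] by (simp add: open_Compl)
    then obtain e where e: "e > 0" "ball x e \<subseteq> - max_comp x"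
      using False open_contains_ball by blast
    have "max_comp x' \<inter> A \<noteq> {}" if x': "x' \<in> J" "x' \<in> ball x e" for x'
    proof (cases "x' \<in> fill (max_comp x)")
      case True
      then show ?thesis using eqJ[OF x(1)] x by metis
    next
      case False
      then have "x' \<in> outer (max_comp x)" using x' JX by (auto simp: fill_def)
      then have "closed_segment x x' \<inter> max_comp x \<noteq> {}"
        using segment_meets[OF xin[OF x(1)]] by blast
      moreover have "closed_segment x x' \<subseteq> ball x e"
        using x' e by (intro closed_segment_subset) auto
      ultimately show ?thesis using e by blast
    qed
    then show ?thesis using e by blast
  qed
  have "connected T"
    unfolding connected_def
  proof clarify
    fix A B
    assume AB: "open A" "open B" "T \<subseteq> A \<union> B" "A \<inter> B \<inter> T = {}" "A \<inter> T \<noteq> {}" "B \<inter> T \<noteq> {}"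
    have one: "max_comp x \<inter> A = {} \<or> max_comp x \<inter> B = {}" if "x \<in> J" for x
    proof -
      have "connected (max_comp x)" "max_comp x \<subseteq> T" using comp_sub(3)[OF mJ(1)[OF that]] that by (auto simp: T_def)
      then show ?thesis
        using connectedD[of "max_comp x" A B] AB by blast
    qed
    have sub: "max_comp x \<subseteq> A \<union> B" "max_comp x \<noteq> {}" if "x \<in> J" for x
      using AB(3) that comp_sub(4)[OF mJ(1)[OF that]] by (auto simp: T_def)
    define JA where "JA = {x \<in> J. max_comp x \<inter> A \<noteq> {}}"
    define JB where "JB = {x \<in> J. max_comp x \<inter> B \<noteq> {}}"
    have opA: "openin (top_of_set J) JA"
      unfolding openin_contains_ball
    proof (intro conjI ballI)
      fix x assume x: "x \<in> JA"
      then have "x \<in> J" "max_comp x \<inter> A \<noteq> {}" by (auto simp: JA_def)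
      moreover have "max_comp x \<subseteq> A" using one[of x] sub[of x] calculation by blast
      ultimately show "\<exists>e>0. ball x e \<inter> J \<subseteq> JA"
        using loc[of x A] AB(1) unfolding JA_def by blast
    qed (auto simp: JA_def)
    have opB: "openin (top_of_set J) JB"
      unfolding openin_contains_ball
    proof (intro conjI ballI)
      fix x assume x: "x \<in> JB"
      then have "x \<in> J" "max_comp x \<inter> B \<noteq> {}" by (auto simp: JB_def)
      moreover have "max_comp x \<subseteq> B" using one[of x] sub[of x] calculation by blast
      ultimately show "\<exists>e>0. ball x e \<inter> J \<subseteq> JB"
        using loc[of x B] AB(2) unfolding JB_def by blast
    qed (auto simp: JB_def)
    have "J \<subseteq> JA \<union> JB" using sub unfolding JA_def JB_def by blast
    moreover have "JA \<inter> JB = {}" using one unfolding JA_def JB_def by blast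
    moreover have "JA \<noteq> {}" "JB \<noteq> {}" using AB(5,6) unfolding JA_def JB_def T_def by blast+
    ultimately show False
      using J(1) opA opB unfolding connected_openin by blast
  qed
  obtain x where x: "x \<in> J" using J by blast
  define M where "M = max_comp x"
  have M: "M \<in> components D" using mJ x by (simp add: M_def)
  have "T \<subseteq> M"
  proof (rule components_maximal[OF M \<open>connected T\<close>])
    show "T \<subseteq> D" using comp_sub(1)[OF mJ(1)] by (auto simp: T_def)
    show "M \<inter> T \<noteq> {}" using comp_sub(4)[OF M] x by (auto simp: T_def M_def)
  qed
  have "z \<in> fill M" if z: "z \<in> J" for z
  proof -
    have "max_comp z \<subseteq> M" using \<open>T \<subseteq> M\<close> z by (auto simp: T_def)
    then have "max_comp z = M"
      using comp_disjoint[OF mJ(1)[OF z] M] comp_sub(4)[OF mJ(1)[OF z]] by blast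
    then show ?thesis using xin[OF z] by simp
  qed
  then show ?thesis using M by blast
qed

text \<open>A separation of the remainder yields a closed separator of two of its points inside the
  union of the fills. Unicoherence extracts a connected piece that still separates them, and one
  \<open>fill M\<close> swallows this piece. But \<open>outer M\<close> is connected, contains both
  points and misses \<open>fill M\<close>.\<close>

lemma connected_outside_fills: "connected (X - \<Union> (fill ` components D))"
proof -
  define Z where "Z = X - \<Union> (fill ` components D)"
  have Zout: "z \<in> outer M" if "z \<in> Z" "M \<in> components D" for z M
    using that by (auto simp: Z_def fill_def)
  have "connected Z"
    unfolding connected_def
  proof clarify
    fix A B
    assume AB: "open A" "open B" "Z \<subseteq> A \<union> B" "A \<inter> B \<inter> Z = {}" "A \<inter> Z \<noteq> {}" "B \<inter> Z \<noteq> {}"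
    define P where "P = A \<inter> Z"
    define Q where "Q = B \<inter> Z"
    obtain u v where uv: "u \<in> P" "v \<in> Q" using AB by (auto simp: P_def Q_def)
    have clP: "q \<notin> closure P" if "q \<in> Q" for q
    proof -
      have "B \<inter> P = {}" using AB by (auto simp: P_def)
      then have "B \<inter> closure P = {}" using AB(2) by (simp add: open_Int_closure_eq_empty)
      then show ?thesis using that by (auto simp: Q_def)
    qed
    have clQ: "q \<notin> closure Q" if "q \<in> P" for q
    proof -
      have "A \<inter> Q = {}" using AB by (auto simp: Q_def)
      then have "A \<inter> closure Q = {}" using AB(1) by (simp add: open_Int_closure_eq_empty)
      then show ?thesis using that by (auto simp: P_def)
    qed
    \<comment> \<open>Its zero set will be the separator. The sign is strict on \<open>P\<close> and
      \<open>Q\<close> because neither meets the closure of the other, so the zero set avoids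
      \<open>Z\<close>.\<close>
    define h where "h x = infdist x P - infdist x Q" for x
    have conth: "continuous_on S h" for S
      unfolding h_def by (intro continuous_intros)
    have hP: "h p < 0" if "p \<in> P" for p
      using that clQ[OF that] uv infdist_nonneg[of p Q] in_closure_iff_infdist_zero[of Q p]
      by (auto simp: h_def less_le)
    have hQ: "h q > 0" if "q \<in> Q" for q
      using that clP[OF that] uv infdist_nonneg[of q P] in_closure_iff_infdist_zero[of P q]
      by (auto simp: h_def less_le)
    define J where "J = {x \<in> X. h x = 0}"
    have clJ: "closed J"
    proof -
      have "J = X \<inter> h -` {0}" by (auto simp: J_def)
      then show ?thesis using continuous_closed_preimage[OF conth clX] by simp
    qed
    have JZ: "J \<inter> Z = {}"
      using hP hQ AB(3) by (fastforce simp: J_def P_def Q_def)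
    have uX: "u \<in> X - J" "v \<in> X - J"
      using uv hP[of u] hQ[of v] by (auto simp: P_def Q_def J_def Z_def)
    define C where "C = connected_component_set (X - J) u"
    have C: "connected C" "C \<subseteq> X - J" "u \<in> C"
      using uX by (auto simp: C_def connected_component_subset)
    have opXJ: "openin (top_of_set X) (X - J)"
      using clJ by (metis openin_diff openin_subtopology_self closed_subset J_def mem_Collect_eq subsetI)
    have locX: "locally connected X"
      using convex_imp_locally_path_connected[OF X(1)] locally_path_connected_imp_locally_connected by blast
    have opC: "openin (top_of_set X) C"
      unfolding C_def using openin_connected_component_locally_connected[of "X - J"]
        locally_open_subset[OF locX opXJ] openin_trans opXJ by blast
    have "v \<notin> C"
    proof
      assume "v \<in> C"
      have "connected (h ` C)" using C conth connected_continuous_image by blast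
      then have "0 \<in> h ` C"
        using connectedD_interval[of "h ` C" "h u" "h v" 0] \<open>v \<in> C\<close> C(3) hP[OF uv(1)] hQ[OF uv(2)] by auto
      then show False using C(2) by (auto simp: J_def)
    qed
    have closC: "closure C \<inter> (X - J) \<subseteq> C"
      using closedin_connected_component[of "X - J" u] C(2)
      by (metis C_def closedin_closed closure_minimal Int_commute Int_mono inf.cobounded2 order_refl)
    have closCX: "closure C \<subseteq> X"
      using C(2) by (intro closure_minimal clX) auto
    have vC: "v \<in> X - closure C" using closC uX \<open>v \<notin> C\<close> by blast
    have opXC: "openin (top_of_set X) (X - closure C)"
      by (metis closCX closed_closure closed_subset openin_diff openin_subtopology_self)
    \<comment> \<open>Passing to a component of the complement of \<open>closure C\<close> makes
      both \<open>E\<close> and \<open>X - E\<close> connected, as unicoherence requires.\<close>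
    define E where "E = connected_component_set (X - closure C) v"
    have E: "connected E" "E \<subseteq> X - closure C" "v \<in> E"
      using vC by (auto simp: E_def connected_component_subset)
    have opE: "openin (top_of_set X) E"
      unfolding E_def using openin_connected_component_locally_connected[of "X - closure C"]
        locally_open_subset[OF locX opXC] openin_trans opXC by blast
    have closE: "closure E \<inter> (X - closure C) \<subseteq> E"
      using closedin_connected_component[of "X - closure C" v] E(2)
      by (metis E_def closedin_closed closure_minimal Int_commute Int_mono inf.cobounded2 order_refl)
    have closEX: "closure E \<subseteq> X"
      using E(2) by (intro closure_minimal clX) auto
    have "E \<in> components (X - closure C)"
      using vC by (auto simp: E_def components_def)
    then have XE: "connected (X - E)"
      using component_diff_connected[OF connected_imp_connected_closure[OF C(1)] connX closCX] by blast
    define J0 where "J0 = closure E - E"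
    have "connected (closure E \<inter> (X - E))"
    proof (rule unicoherentD[OF convex_imp_unicoherent[OF X(1)] connected_imp_connected_closure[OF E(1)] XE])
      show "X = closure E \<union> (X - E)" using closEX closure_subset[of E] by blast
      show "closedin (top_of_set X) (closure E)" using closEX by (simp add: closed_subset)
      show "closedin (top_of_set X) (X - E)" using opE by (simp add: closedin_diff)
    qed
    moreover have "closure E \<inter> (X - E) = J0" using closEX by (auto simp: J0_def)
    ultimately have J0: "connected J0" by simp
    have J0C: "J0 \<subseteq> closure C" using closE closEX by (auto simp: J0_def)
    have "C \<inter> closure E = {}"
    proof -
      obtain U where U: "open U" "C = X \<inter> U" using opC by (auto simp: openin_open)
      have "U \<inter> E = {}" using E(2) U closure_subset[of C] by blast
      then show ?thesis using U open_Int_closure_eq_empty[of U E] by blast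
    qed
    \<comment> \<open>The frontier of \<open>E\<close> lies in \<open>closure C\<close> but misses
      \<open>C\<close>, and \<open>C\<close> is relatively closed in \<open>X - J\<close>.\<close>
    then have "J0 \<subseteq> J" using J0C closC closCX by (auto simp: J0_def)
    then have J0f: "J0 \<subseteq> \<Union> (fill ` components D)"
      using JZ by (auto simp: J_def Z_def)
    have uE: "u \<notin> E" using E(2) C(3) closure_subset by blast
    have "X \<inter> J0 \<noteq> {}"
      unfolding J0_def by (rule connected_meets_relative_frontier[OF opE connX]) (use uE uX E in auto)
    then obtain M where M: "M \<in> components D" "J0 \<subseteq> fill M"
      using connected_subset_fill[OF J0 _ J0f] by blast
    have "u \<in> outer M" "v \<in> outer M"
      using Zout[OF _ M(1)] uv by (auto simp: P_def Q_def)
    then have "outer M \<inter> J0 \<noteq> {}"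
      unfolding J0_def using outer_sub[of M] uE E
      by (intro connected_meets_relative_frontier[OF opE outer_connected]) auto
    then show False using M(2) by (auto simp: fill_def)
  qed
  then show ?thesis by (simp add: Z_def)
qed

lemma no_crossing: "\<not> (F a < y \<and> y < F b)"
proof
  assume y: "F a < y \<and> y < F b"
  define Z where "Z = X - \<Union> (fill ` components D)"
  have "a \<in> Z" "b \<in> Z"
    using ab a_outer b_outer by (auto simp: Z_def fill_def)
  moreover have "connected (F ` Z)"
    by (rule connectivity_on_connected_image[OF F]) (use connected_outside_fills in \<open>auto simp: Z_def\<close>)
  ultimately have "y \<in> F ` Z"
    using connectedD_interval[of "F ` Z" "F a" "F b" y] y by auto
  then obtain z where z: "z \<in> Z" "F z = y" by blast
  define M where "M = connected_component_set D z"
  have "z \<in> D" using z by (auto simp: D_def Z_def)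
  then have "M \<in> components D" "z \<in> M" by (auto simp: M_def components_def)
  then show False using z(1) sub_fill by (auto simp: Z_def)
qed

end

theorem connectivity_level_set_separates:
  fixes X :: "'a::euclidean_space set"
  assumes "connectivity_on X F" "convex X" "compact X" "a \<in> X" "b \<in> X"
    and "\<And>x. x \<in> X \<Longrightarrow> closed_segment x a \<inter> closed_segment x b \<subseteq> {x}"
    and y: "F a < y" "y < F b"
  obtains M where "connected M" "M \<subseteq> X" "F ` M \<subseteq> {y}" "b \<notin> connected_component_set (X - M) a"
proof -
  have "\<exists>M\<in>components {x \<in> X. F x = y}. b \<notin> connected_component_set (X - M) a"
  proof (rule ccontr)
    assume "\<not> ?thesis"
    then interpret nonseparating_level_set X F y a b
      using assms by unfold_locales auto
    show False using no_crossing y by simp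
  qed
  then obtain M where "M \<in> components {x \<in> X. F x = y}" "b \<notin> connected_component_set (X - M) a"
    by blast
  then show ?thesis
    using that[of M] in_components_subset in_components_connected by fastforce
qed

section \<open>Extendable functions\<close>

lemma interval_covered_by_closed_sets:
  fixes C :: "nat \<Rightarrow> real set"
  assumes "l < u" and C: "\<And>n. closed (C n)" "{l<..<u} \<subseteq> (\<Union>n. C n)"
  shows "\<exists>n c d. c < d \<and> {c<..<d} \<subseteq> C n"
proof (rule ccontr)
  assume no: "\<not> ?thesis"
  define S where "S = {l..u}"
  have "S \<subseteq> closure (\<Inter> (range (\<lambda>n. S - C n)))"
  proof (rule Baire)
    show "closed S" "countable (range (\<lambda>n. S - C n))" by (auto simp: S_def)
    fix T assume "T \<in> range (\<lambda>n. S - C n)"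
    then obtain n where T: "T = S - C n" by blast
    have "openin (top_of_set S) T"
      unfolding T using C(1)[of n] by (metis Diff_eq open_Compl openin_open_Int)
    moreover have "s \<in> closure T" if s: "s \<in> S" for s
      unfolding closure_approachable
    proof (intro allI impI)
      fix e :: real assume "e > 0"
      define c where "c = max l (s - e)"
      define d where "d = min u (s + e)"
      have "c < d" using \<open>e > 0\<close> s \<open>l < u\<close> by (auto simp: c_def d_def S_def)
      then obtain t where "t \<in> {c<..<d}" "t \<notin> C n" using no by blast
      then show "\<exists>t\<in>T. dist t s < e"
        by (intro bexI[of _ t]) (auto simp: T S_def c_def d_def dist_real_def)
    qed
    ultimately show "openin (top_of_set S) T \<and> S \<subseteq> closure T" by blast
  qed
  \<comment> \<open>Only the open interval is covered, so the endpoints may survive in the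
    intersection; two points are still not dense in \<open>S\<close>.\<close>
  moreover have "\<Inter> (range (\<lambda>n. S - C n)) \<subseteq> {l, u}"
    using C(2) by (force simp: S_def)
  then have "closure (\<Inter> (range (\<lambda>n. S - C n))) \<subseteq> {l, u}"
    by (intro closure_minimal) auto
  moreover have "(l + u) / 2 \<in> S" using \<open>l < u\<close> by (simp add: S_def)
  ultimately have "(l + u) / 2 \<in> {l, u}" by blast
  then show False using \<open>l < u\<close> by auto
qed

text \<open>The first coordinate does not increase towards \<open>(a, 0)\<close> and does not
  decrease towards \<open>(b, 0)\<close>. At a common point it therefore equals
  \<open>fst x\<close>, and since \<open>a < b\<close> one of the parameters \<open>s\<close>,
  \<open>t\<close> must be 0.\<close>

lemma base_corners_visible:
  fixes a b :: real and x :: "real \<times> real"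
  assumes "a < b" "x \<in> {a..b} \<times> T"
  shows "closed_segment x (a, 0) \<inter> closed_segment x (b, 0) \<subseteq> {x}"
proof
  fix p assume "p \<in> closed_segment x (a, 0) \<inter> closed_segment x (b, 0)"
  then obtain s t where st: "0 \<le> s" "0 \<le> t" "p = (1 - s) *\<^sub>R x + s *\<^sub>R (a, 0)" "p = (1 - t) *\<^sub>R x + t *\<^sub>R (b, 0)"
    by (auto simp: closed_segment_def)
  have x: "a \<le> fst x" "fst x \<le> b" using assms by auto
  have "fst p = (1 - s) * fst x + s * a" "fst p = (1 - t) * fst x + t * b"
    using st(3) st(4) by (metis fst_add fst_scaleR fst_conv real_scaleR_def)+
  then have "fst p = fst x - s * (fst x - a)" "fst p = fst x + t * (b - fst x)"
    by (auto simp: algebra_simps)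
  moreover have "s * (fst x - a) \<ge> 0" "t * (b - fst x) \<ge> 0" using x st by auto
  ultimately have "s * (fst x - a) = 0" "t * (b - fst x) = 0" by linarith+
  then have "s = 0 \<or> t = 0" using \<open>a < b\<close> by auto
  then show "p \<in> {x}" using st(3,4) by (auto simp: prod_eq_iff)
qed

text \<open>A separating level component meets the base at some \<open>(x, 0)\<close>, where
  \<open>f x = y\<close>, and also the union of the other three sides, so it is nondegenerate. No
  uniform lower bound for its size is at hand, hence the countable decomposition by size: a fixed
  lower bound survives limits, which keeps each closure in the graph.\<close>

theorem extendable_graph_contains_closed_set:
  assumes "extendable f" "a < b" "f a < f b"
  shows "\<exists>G c d. closed G \<and> G \<subseteq> graph_on f UNIV \<and> c < d \<and> {c<..<d} \<subseteq> snd ` G"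
proof -
  obtain F :: "real \<times> real \<Rightarrow> real" where F: "connectivity_on (UNIV \<times> {0..1}) F" and f: "\<forall>x. f x = F (x, 0)"
    using assms(1) unfolding extendable_def by blast
  define X where "X = {a..b} \<times> {0..1::real}"
  have FX: "connectivity_on X F"
    using F by (auto simp: connectivity_on_def X_def)
  have X: "convex X" "compact X"
    by (auto simp: X_def convex_Times compact_Times)
  define P where "P n x y K q \<longleftrightarrow> connected K \<and> K \<subseteq> X \<and> F ` K \<subseteq> {y} \<and> (x, 0) \<in> K \<and> q \<in> K
      \<and> inverse (real (Suc n)) \<le> dist q (x, 0)" for n x y K q
  define G where "G n = {(x, y). f a \<le> y \<and> y \<le> f b \<and> (\<exists>K q. P n x y K q)}" for n
  have PX: "(x, 0) \<in> X" "q \<in> X" if "P n x y K q" for n x y K q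
    using that by (auto simp: P_def)
  have graph: "closure (G n) \<subseteq> graph_on f UNIV" for n
  proof
    fix p assume "p \<in> closure (G n)"
    then obtain g where g: "\<And>i. g i \<in> G n" "g \<longlonglongrightarrow> p"
      by (auto simp: closure_sequential)
    have "\<exists>K q. P n (fst (g i)) (snd (g i)) K q" for i
      using g(1)[of i] by (cases "g i") (simp add: G_def)
    then obtain K q where KQ: "\<And>i. P n (fst (g i)) (snd (g i)) (K i) (q i)"
      by metis
    obtain l r where r: "strict_mono r" "l \<in> X" "(q \<circ> r) \<longlonglongrightarrow> l"
      using PX(2)[OF KQ] X(2) unfolding compact_def by metis
    have gr: "(\<lambda>i. g (r i)) \<longlonglongrightarrow> p"
      using LIMSEQ_subseq_LIMSEQ[OF g(2) r(1)] by (simp add: o_def)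
    have lim: "(\<lambda>i. (fst (g (r i)), 0)) \<longlonglongrightarrow> (fst p, 0::real)"
      by (intro tendsto_intros gr)
    have qr: "(\<lambda>i. q (r i)) \<longlonglongrightarrow> l" using r(3) by (simp add: o_def)
    have "inverse (real (Suc n)) \<le> dist l (fst p, 0)"
    proof (rule LIMSEQ_le_const)
      show "(\<lambda>i. dist (q (r i)) (fst (g (r i)), 0)) \<longlonglongrightarrow> dist l (fst p, 0)"
        by (intro tendsto_intros lim qr gr)
      show "\<exists>N. \<forall>i\<ge>N. inverse (real (Suc n)) \<le> dist (q (r i)) (fst (g (r i)), 0)"
        using KQ by (auto simp: P_def)
    qed
    then have "l \<noteq> (fst p, 0)"
      by (metis dist_self inverse_positive_iff_positive not_le of_nat_0_less_iff zero_less_Suc)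
    moreover have "(fst p, 0) \<in> X"
      using closed_sequentially[OF compact_imp_closed[OF X(2)] _ lim] PX(1)[OF KQ] by blast
    moreover have "(\<lambda>i. snd (g (r i))) \<longlonglongrightarrow> snd p"
      by (intro tendsto_intros gr)
    ultimately have "F (fst p, 0) = snd p"
      using connectivity_on_limit_value[OF FX X(1), of "\<lambda>i. K (r i)" "\<lambda>i. snd (g (r i))" "\<lambda>i. q (r i)"
          "\<lambda>i. (fst (g (r i)), 0)" l "(fst p, 0)" "snd p"] KQ lim qr
      unfolding P_def by blast
    then show "p \<in> graph_on f UNIV"
      by (auto simp: graph_on_def f intro!: image_eqI[of _ _ "fst p"] prod_eqI)
  qed
  have "G n \<subseteq> {a..b} \<times> {f a..f b}" for n
    using PX(1) by (fastforce simp: G_def X_def)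
  then have "bounded (G n)" for n
    by (rule bounded_subset[rotated]) (intro bounded_Times bounded_closed_interval)
  then have "compact (snd ` closure (G n))" for n
    by (intro compact_continuous_image continuous_intros) (simp add: compact_eq_bounded_closed bounded_closure)
  then have closed: "closed (snd ` closure (G n))" for n
    by (rule compact_imp_closed)
  have "{f a<..<f b} \<subseteq> (\<Union>n. snd ` closure (G n))"
  proof
    fix y assume y: "y \<in> {f a<..<f b}"
    obtain M where M: "connected M" "M \<subseteq> X" "F ` M \<subseteq> {y}" "(b, 0) \<notin> connected_component_set (X - M) (a, 0)"
    proof (rule connectivity_level_set_separates[OF FX X, of "(a, 0)" "(b, 0)" y])
      show "(a, 0) \<in> X" "(b, 0) \<in> X" using assms by (auto simp: X_def)
      show "closed_segment x (a, 0) \<inter> closed_segment x (b, 0) \<subseteq> {x}" if "x \<in> X" for x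
        using base_corners_visible[OF \<open>a < b\<close>] that by (simp add: X_def)
      show "F (a, 0) < y" "y < F (b, 0)" using y f by auto
    qed
    have meets: "R \<inter> M \<noteq> {}" if R: "connected R" "R \<subseteq> X" "(a, 0) \<in> R" "(b, 0) \<in> R" for R
    proof
      assume "R \<inter> M = {}"
      then have "R \<subseteq> connected_component_set (X - M) (a, 0)"
        using R by (intro connected_component_maximal) auto
      then show False using R M by blast
    qed
    have "({a..b} \<times> {0}) \<inter> M \<noteq> {}"
      using \<open>a < b\<close> by (intro meets connected_Times) (auto simp: X_def)
    then obtain x where x: "(x, 0) \<in> M" by auto
    \<comment> \<open>The other three sides of the rectangle; they also join the corners, so
      \<open>M\<close> reaches them.\<close>
    define R where "R = ({a} \<times> {0..1}) \<union> (({a..b} \<times> {1}) \<union> ({b} \<times> {0..1::real}))"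
    have "connected R"
      unfolding R_def
    proof (intro connected_Un connected_Times)
      have "(b, 1) \<in> {b} \<times> {0..1::real}" "(b, 1::real) \<in> {a..b} \<times> {1}"
        using \<open>a < b\<close> by auto
      then show "({a..b} \<times> {1}) \<inter> ({b} \<times> {0..1::real}) \<noteq> {}"
        by blast
      have "(a, 1) \<in> {a} \<times> {0..1::real}" "(a, 1::real) \<in> {a..b} \<times> {1}"
        using \<open>a < b\<close> by auto
      then show "({a} \<times> {0..1}) \<inter> (({a..b} \<times> {1}) \<union> ({b} \<times> {0..1::real})) \<noteq> {}"
        by blast
    qed auto
    then have "R \<inter> M \<noteq> {}"
      using \<open>a < b\<close> by (intro meets) (auto simp: R_def X_def)
    then obtain q where q: "q \<in> M" "q \<in> R" by blast
    \<comment> \<open>\<open>R\<close> meets the base only in the two corners, where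
      \<open>F\<close> takes the values \<open>f a\<close> and \<open>f b\<close>, not
      \<open>y\<close>.\<close>
    have "q \<noteq> (x, 0)"
      using q M(3) y f by (auto simp: R_def)
    then have "dist q (x, 0) > 0" by simp
    then obtain n where "inverse (real (Suc n)) < dist q (x, 0)"
      using reals_Archimedean by blast
    then have "P n x y M q" using M x q by (simp add: P_def)
    then have "(x, y) \<in> G n" using y unfolding G_def by (simp del: split_paired_Ex) blast
    then show "y \<in> (\<Union>n. snd ` closure (G n))"
      using closure_subset[of "G n"] by force
  qed
  then obtain n c d where "c < d" "{c<..<d} \<subseteq> snd ` closure (G n)"
    using interval_covered_by_closed_sets[of "f a" "f b" "\<lambda>n. snd ` closure (G n)"] assms(3) closed
    by metis
  then show ?thesis
    using graph[of n] closed_closure[of "G n"] by blast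
qed

section \<open>Almost continuity and the Cantor intermediate value property\<close>

text \<open>Abscissae whose entire vertical line lies in \<open>U\<close> are dense, because the
  closed complement of \<open>U\<close> misses the graph of \<open>f\<close>. Continuous pieces
  vanishing at such abscissae can be glued. Pieces exist locally near each \<open>(x, f x)\<close>,
  and connectedness of the line provides them between any two such abscissae.\<close>

lemma almost_continuousI:
  assumes meets: "\<And>B c d. closed B \<Longrightarrow> c < d \<Longrightarrow> {c<..<d} \<subseteq> fst ` B \<Longrightarrow> \<exists>x. (x, f x) \<in> B"
  shows "almost_continuous f"
  unfolding almost_continuous_def
proof (intro allI impI, elim conjE)
  fix U :: "(real \<times> real) set"
  assume U: "open U" and fU: "graph_on f UNIV \<subseteq> U"
  define N where "N = {z. \<forall>t. (z, t) \<in> U}"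
  have dense: "\<exists>z\<in>N. c < z \<and> z < d" if "c < d" for c d
  proof (rule ccontr)
    assume "\<not> ?thesis"
    then have "{c<..<d} \<subseteq> fst ` (- U)"
      by (force simp: N_def)
    moreover have "closed (- U)" using U by (simp add: closed_Compl)
    ultimately obtain x where "(x, f x) \<in> - U" using meets \<open>c < d\<close> by blast
    then show False using fU by (auto simp: graph_on_def)
  qed
  define Z where "Z p q g \<longleftrightarrow> continuous_on UNIV g \<and> (\<forall>x. x \<le> p \<or> q \<le> x \<longrightarrow> g x = 0)
      \<and> (\<forall>x\<in>{p..q}. (x, g x) \<in> U)" for p q and g :: "real \<Rightarrow> real"
  have local: "\<exists>e>0. \<forall>u\<in>N. \<forall>v\<in>N. x - e < u \<and> u < v \<and> v < x + e \<longrightarrow> (\<exists>g. Z u v g)" for x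
  proof -
    define c where "c = f x"
    have "(x, c) \<in> U" using fU by (auto simp: graph_on_def c_def)
    then obtain e where e: "e > 0" "ball (x, c) e \<subseteq> U"
      using U open_contains_ball by blast
    have "\<exists>g. Z u v g" if uv: "u \<in> N" "v \<in> N" "x - e < u" "u < v" "v < x + e" for u v
    proof -
      \<comment> \<open>The compact segment of heights up to \<open>\<bar>c\<bar>\<close> over
        \<open>z\<close> has a neighbourhood inside \<open>U\<close>; there a piece may climb from 0
        to \<open>c\<close>.\<close>
      have tube: "\<exists>d>0. \<forall>s t. \<bar>s - z\<bar> < d \<and> \<bar>t\<bar> \<le> \<bar>c\<bar> \<longrightarrow> (s, t) \<in> U" if z: "z \<in> N" for z
      proof -
        have "compact ({z} \<times> {-\<bar>c\<bar>..\<bar>c\<bar>})" by (intro compact_Times) auto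
        moreover have "{z} \<times> {-\<bar>c\<bar>..\<bar>c\<bar>} \<subseteq> U" using z by (auto simp: N_def)
        ultimately obtain d where d: "d > 0" "(\<Union>p\<in>{z} \<times> {-\<bar>c\<bar>..\<bar>c\<bar>}. ball p d) \<subseteq> U"
          using compact_subset_open_imp_ball_epsilon_subset[OF _ U] by metis
        have "(s, t) \<in> U" if "\<bar>s - z\<bar> < d" "\<bar>t\<bar> \<le> \<bar>c\<bar>" for s t
        proof -
          have "(s, t) \<in> ball (z, t) d" using that by (simp add: dist_Pair_Pair dist_real_def)
          moreover have "(z, t) \<in> {z} \<times> {-\<bar>c\<bar>..\<bar>c\<bar>}" using that by auto
          ultimately show ?thesis using d by blast
        qed
        then show ?thesis using d by blast
      qed
      obtain d1 where d1: "d1 > 0" "\<And>s t. \<bar>s - u\<bar> < d1 \<Longrightarrow> \<bar>t\<bar> \<le> \<bar>c\<bar> \<Longrightarrow> (s, t) \<in> U"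
        using tube[OF uv(1)] by blast
      obtain d2 where d2: "d2 > 0" "\<And>s t. \<bar>s - v\<bar> < d2 \<Longrightarrow> \<bar>t\<bar> \<le> \<bar>c\<bar> \<Longrightarrow> (s, t) \<in> U"
        using tube[OF uv(2)] by blast
      define d where "d = min d1 d2"
      have d: "d > 0" using d1 d2 by (simp add: d_def)
      \<comment> \<open>A trapezoid: 0 at \<open>u\<close> and \<open>v\<close>, and 1 at distance
        at least \<open>d\<close> from both.\<close>
      define h where "h s = max 0 (min 1 (min ((s - u) / d) ((v - s) / d)))" for s
      define g where "g s = c * h s" for s
      have h: "0 \<le> h s" "h s \<le> 1" for s by (auto simp: h_def)
      have gc: "\<bar>g s\<bar> \<le> \<bar>c\<bar>" for s
        using h[of s] by (simp add: g_def abs_mult mult_left_le)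
      have "Z u v g"
        unfolding Z_def
      proof (intro conjI allI impI ballI)
        show "continuous_on UNIV g"
          unfolding g_def h_def using d by (intro continuous_intros) auto
        show "g s = 0" if "s \<le> u \<or> v \<le> s" for s
        proof -
          have "(s - u) / d \<le> 0 \<or> (v - s) / d \<le> 0"
            using that d by (auto simp: divide_le_0_iff)
          then show ?thesis by (auto simp: g_def h_def)
        qed
        show "(s, g s) \<in> U" if s: "s \<in> {u..v}" for s
        proof (cases "s - u < d \<or> v - s < d")
          case True
          then show ?thesis using d1(2)[of s "g s"] d2(2)[of s "g s"] gc s by (auto simp: d_def)
        next
          case False
          then have "1 \<le> (s - u) / d" "1 \<le> (v - s) / d" using d by (auto simp: le_divide_eq)
          then have "g s = c" by (auto simp: g_def h_def)
          moreover have "(s, c) \<in> ball (x, c) e"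
            using s uv by (simp add: dist_Pair_Pair dist_real_def abs_less_iff)
          ultimately show ?thesis using e by auto
        qed
      qed
      then show ?thesis by blast
    qed
    then show ?thesis using e by blast
  qed
  \<comment> \<open>Asking for all pairs between \<open>u\<close> and \<open>v\<close>, not only for
    the pair itself, makes the relation transitive even when the middle point lies outside the
    interval spanned by the other two.\<close>
  define R where "R u v \<longleftrightarrow> u \<in> N \<and> v \<in> N \<and>
    (\<forall>p\<in>N. \<forall>q\<in>N. p < q \<and> min u v \<le> p \<and> q \<le> max u v \<longrightarrow> (\<exists>g. Z p q g))" for u v
  have join: "\<exists>g. Z p q g" if "Z p v g1" "Z v q g2" "p < v" "v < q" for p q v g1 g2
  proof -
    have "Z p q (\<lambda>x. g1 x + g2 x)"
      unfolding Z_def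
    proof (intro conjI allI impI ballI)
      show "continuous_on UNIV (\<lambda>x. g1 x + g2 x)"
        using that by (intro continuous_intros) (auto simp: Z_def)
      show "g1 x + g2 x = 0" if "x \<le> p \<or> q \<le> x" for x
        using that \<open>Z p v g1\<close> \<open>Z v q g2\<close> \<open>p < v\<close> \<open>v < q\<close> by (auto simp: Z_def)
      show "(x, g1 x + g2 x) \<in> U" if "x \<in> {p..q}" for x
        using that \<open>Z p v g1\<close> \<open>Z v q g2\<close> by (cases "x \<le> v") (auto simp: Z_def)
    qed
    then show ?thesis by blast
  qed
  have trans: "R u w" if "R u v" "R v w" for u v w
    unfolding R_def
  proof (intro conjI ballI impI; (elim conjE)?)
    show "u \<in> N" "w \<in> N" using that by (auto simp: R_def)
    fix p q assume pq: "p \<in> N" "q \<in> N" "p < q" "min u w \<le> p" "q \<le> max u w"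
    have v: "v \<in> N" using that by (simp add: R_def)
    have R1: "\<exists>g. Z p q g" if "p \<in> N" "q \<in> N" "p < q" "min u v \<le> p \<and> q \<le> max u v \<or> min v w \<le> p \<and> q \<le> max v w" for p q
      using that \<open>R u v\<close> \<open>R v w\<close> unfolding R_def by blast
    show "\<exists>g. Z p q g"
    proof (cases "p < v \<and> v < q")
      case True
      then have "min u v \<le> p \<and> v \<le> max u v \<or> min v w \<le> p \<and> v \<le> max v w"
        "min u v \<le> v \<and> q \<le> max u v \<or> min v w \<le> v \<and> q \<le> max v w"
        using pq by linarith+
      then obtain g1 g2 where "Z p v g1" "Z v q g2"
        using R1[of p v] R1[of v q] True pq v by blast
      then show ?thesis using join True by blast
    next
      case False
      then have "min u v \<le> p \<and> q \<le> max u v \<or> min v w \<le> p \<and> q \<le> max v w"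
        using pq by linarith
      then show ?thesis using R1 pq by blast
    qed
  qed
  have R: "R a b" if ab: "a \<in> N" "b \<in> N" for a b
  proof (rule connected_equivalence_relation_gen[of UNIV a b "\<lambda>x. x \<in> N"])
    show "\<exists>z. z \<in> T \<and> z \<in> N" if T: "openin (top_of_set UNIV) T" "x \<in> T" for T and x :: real
    proof -
      have "open T" using T by simp
      then obtain e where e: "e > 0" "ball x e \<subseteq> T"
        using T open_contains_ball by blast
      obtain z where "z \<in> N" "x < z" "z < x + e" using dense[of x "x + e"] e by auto
      then show ?thesis using e by (intro exI[of _ z]) (auto simp: dist_real_def)
    qed
    show "\<exists>T. openin (top_of_set UNIV) T \<and> x \<in> T \<and> (\<forall>u\<in>T. \<forall>v\<in>T. u \<in> N \<and> v \<in> N \<longrightarrow> R u v)" for x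
    proof -
      obtain e where e: "e > 0" "\<And>u v. u \<in> N \<Longrightarrow> v \<in> N \<Longrightarrow> x - e < u \<Longrightarrow> u < v \<Longrightarrow> v < x + e \<Longrightarrow> \<exists>g. Z u v g"
        using local[of x] by blast
      have "R u v" if "u \<in> {x-e<..<x+e}" "v \<in> {x-e<..<x+e}" "u \<in> N" "v \<in> N" for u v
        unfolding R_def
      proof (intro conjI ballI impI; (elim conjE)?)
        fix p q assume "p \<in> N" "q \<in> N" "p < q" "min u v \<le> p" "q \<le> max u v"
        then show "\<exists>g. Z p q g" using that by (intro e) auto
      qed (use that in auto)
      then show ?thesis using e(1) by (intro exI[of _ "{x-e<..<x+e}"]) auto
    qed
  qed (use ab trans in auto)
  have "\<exists>z\<in>N. real_of_int n < z \<and> z < real_of_int n + 1" for n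
    by (rule dense) simp
  then obtain z where z: "\<And>n. z n \<in> N" "\<And>n. real_of_int n < z n" "\<And>n. z n < real_of_int n + 1"
    by metis
  have zless: "z n < z (n + 1)" for n
    using z(3)[of n] z(2)[of "n+1"] by simp
  have "\<exists>g. Z (z n) (z (n + 1)) g" for n
    using R[of "z n" "z (n + 1)"] z(1) zless[of n] unfolding R_def by auto
  then obtain g where g: "\<And>n. Z (z n) (z (n + 1)) (g n)"
    by metis
  have g0: "g n x = 0" if "x \<le> z n \<or> z (n + 1) \<le> x" for n x
    using g[of n] that by (auto simp: Z_def)
  \<comment> \<open>\<open>g j\<close> vanishes outside the interval from \<open>j\<close> to
    \<open>j + 2\<close>, so only the indices \<open>\<lfloor>x\<rfloor> - 1\<close> and
    \<open>\<lfloor>x\<rfloor>\<close> can contribute; the window is generous.\<close>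
  define G where "G x = (\<Sum>j\<in>{\<lfloor>x\<rfloor>-2..\<lfloor>x\<rfloor>+2}. g j x)" for x
  \<comment> \<open>One window for a whole interval around an integer, so that \<open>G\<close> is
    locally a fixed finite sum also where the floor jumps.\<close>
  have G: "G x = (\<Sum>j\<in>{n-3..n+2}. g j x)" if x: "real_of_int n - 1 < x" "x < real_of_int n + 1" for n x
    unfolding G_def
  proof (rule sum.mono_neutral_left)
    have fl: "\<lfloor>x\<rfloor> = n - 1 \<or> \<lfloor>x\<rfloor> = n"
      using x by linarith
    then show "{\<lfloor>x\<rfloor>-2..\<lfloor>x\<rfloor>+2} \<subseteq> {n-3..n+2}" by auto
    show "\<forall>j\<in>{n-3..n+2} - {\<lfloor>x\<rfloor>-2..\<lfloor>x\<rfloor>+2}. g j x = 0"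
    proof
      fix j assume j: "j \<in> {n-3..n+2} - {\<lfloor>x\<rfloor>-2..\<lfloor>x\<rfloor>+2}"
      then have "j + 3 \<le> \<lfloor>x\<rfloor> \<or> \<lfloor>x\<rfloor> + 3 \<le> j" by auto
      then have "z (j + 1) \<le> x \<or> x \<le> z j"
        using z(2)[of j] z(3)[of "j+1"] by linarith
      then show "g j x = 0" using g0 by blast
    qed
  qed auto
  have "isCont G x" for x
  proof -
    define n where "n = \<lfloor>x\<rfloor>"
    have "continuous_on {real_of_int n - 1<..<real_of_int n + 1} (\<lambda>x. \<Sum>j\<in>{n-3..n+2}. g j x)"
      using g by (intro continuous_on_sum) (auto simp: Z_def intro: continuous_on_subset)
    then have "continuous_on {real_of_int n - 1<..<real_of_int n + 1} G"
      using G by (subst continuous_on_cong[OF refl, of _ G]) auto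
    moreover have "x \<in> {real_of_int n - 1<..<real_of_int n + 1}"
      unfolding n_def greaterThanLessThan_iff by linarith
    ultimately show ?thesis
      by (simp add: continuous_on_eq_continuous_at)
  qed
  then have "continuous_on UNIV G"
    by (simp add: continuous_at_imp_continuous_on)
  moreover have "(x, G x) \<in> U" for x
  proof -
    define n where "n = (if x < z \<lfloor>x\<rfloor> then \<lfloor>x\<rfloor> - 1 else \<lfloor>x\<rfloor>)"
    have n: "z n \<le> x" "x \<le> z (n + 1)"
      using z(2)[of "\<lfloor>x\<rfloor> + 1"] z(3)[of "\<lfloor>x\<rfloor> - 1"] unfolding n_def by (auto split: if_splits; linarith)+
    have mono: "z i \<le> z j" if "i \<le> j" for i j
    proof (cases "i = j")
      case False
      then have "real_of_int i + 1 \<le> real_of_int j" using that by linarith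
      then show ?thesis using z(3)[of i] z(2)[of j] by linarith
    qed simp
    have "g j x = 0" if "j \<noteq> n" for j
    proof (rule g0)
      show "x \<le> z j \<or> z (j + 1) \<le> x"
        using that n mono[of "n+1" j] mono[of "j+1" n] by (cases "j < n") auto
    qed
    then have "G x = (\<Sum>j\<in>{n}. g j x)"
      unfolding G_def by (intro sum.mono_neutral_right) (auto simp: n_def)
    then have "G x = g n x" by simp
    then show ?thesis using g[of n] n by (auto simp: Z_def)
  qed
  ultimately show "\<exists>g. continuous_on UNIV g \<and> graph_on g UNIV \<subseteq> U"
    by (intro exI[of _ G]) (auto simp: graph_on_def)
qed

text \<open>Since \<open>f\<close> will be constant on the new Cantor set, a single value
  \<open>k\<close> of \<open>K\<close> suffices. Every level is dense, so some point between
  \<open>x\<close> and \<open>y\<close> has value \<open>k\<close>, and a small copy of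
  \<open>C\<close> is attached to it. The copy has empty interior because the level
  \<open>k + 1\<close> is dense too.\<close>

lemma scivpI:
  assumes add: "Modules.additive f"
    and meets: "\<And>B c d. closed B \<Longrightarrow> c < d \<Longrightarrow> {c<..<d} \<subseteq> fst ` B \<Longrightarrow> \<exists>x. (x, f x) \<in> B"
    and C: "compact C" "C \<noteq> {}" "\<And>x. x \<in> C \<Longrightarrow> \<not> x isolated_in C"
    and ker: "\<And>c n. c \<in> C \<Longrightarrow> f (c / real (Suc n)) = 0"
  shows "scivp f"
  unfolding scivp_def
proof (intro allI impI, elim conjE)
  fix x y K assume K: "cantor_set K" "K \<subseteq> open_segment (f x) (f y)"
  have level: "\<exists>z. c < z \<and> z < d \<and> f z = k" if cd0: "c < d" for c d k
  proof -
    \<comment> \<open>The closed segment used below must lie inside the open interval, while its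
      projection still contains an open one.\<close>
    obtain d' where "c < d'" "d' < d" using dense[OF cd0] by blast
    moreover obtain c' where "c < c'" "c' < d'" using dense[OF \<open>c < d'\<close>] by blast
    ultimately have cd: "c < c'" "c' < d'" "d' < d" by auto
    have "\<exists>z. (z, f z) \<in> {c'..d'} \<times> {k}"
      using cd by (intro meets[of _ c' d'] closed_Times) (auto simp: image_iff)
    then obtain z where "z \<in> {c'..d'}" "f z = k" by blast
    then show ?thesis using cd by (intro exI[of _ z]) auto
  qed
  obtain k where k: "k \<in> K" using K by (auto simp: cantor_set_def)
  then have "x \<noteq> y" using K by (auto simp: open_segment_def)
  then have "min x y < max x y" by auto
  then obtain z where z: "min x y < z" "z < max x y" "f z = k" using level by blast
  obtain B where B: "B > 0" "\<And>c. c \<in> C \<Longrightarrow> \<bar>c\<bar> < B"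
    using compact_imp_bounded[OF C(1)] unfolding bounded_pos_less by auto
  define e where "e = min (z - min x y) (max x y - z)"
  have "e / B > 0" using z B by (auto simp: e_def)
  then obtain n where "inverse (real (Suc n)) < e / B" using reals_Archimedean by blast
  then have n: "B / real (Suc n) < e" using B by (simp add: field_simps)
  define \<phi> where "\<phi> c = z + c / real (Suc n)" for c
  define C' where "C' = \<phi> ` C"
  have fC: "f w = k" if "w \<in> C'" for w
    using that ker[of _ n] z(3) additive.add[OF add] by (auto simp: C'_def \<phi>_def)
  have near: "\<bar>\<phi> c - z\<bar> < e" if "c \<in> C" for c
  proof -
    have "\<bar>c\<bar> / real (Suc n) < B / real (Suc n)" using B(2)[OF that] by (intro divide_strict_right_mono) auto
    then show ?thesis using n by (simp add: \<phi>_def)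
  qed
  have clC: "closed C'"
    unfolding C'_def \<phi>_def by (intro compact_imp_closed compact_continuous_image continuous_intros C) auto
  have "\<not> w isolated_in C'" if w: "w \<in> C'" for w
  proof
    assume "w isolated_in C'"
    then obtain r where r: "r > 0" "\<And>v. v \<in> C' \<Longrightarrow> dist w v < r \<Longrightarrow> v = w"
      by (auto simp: isolated_in_dist_Ex_iff)
    obtain c where c: "c \<in> C" "w = \<phi> c" using w by (auto simp: C'_def)
    have "c isolated_in C"
      unfolding isolated_in_dist_Ex_iff
    proof (intro conjI exI ballI impI)
      show "c \<in> C" by fact
      show "r > 0" by fact
      fix v assume v: "v \<in> C" "dist c v < r"
      have "dist (\<phi> c) (\<phi> v) = dist c v / real (Suc n)"
        by (simp add: \<phi>_def dist_real_def abs_divide flip: diff_divide_distrib)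
      also have "\<dots> \<le> dist c v" by (simp add: divide_le_eq mult_right_le_one_le algebra_simps)
      finally have "\<phi> v = \<phi> c" using r(2)[of "\<phi> v"] v c by (auto simp: C'_def)
      then show "v = c" by (simp add: \<phi>_def)
    qed
    then show False using C(3) c by blast
  qed
  moreover have "interior (closure C') = {}"
  proof (rule ccontr)
    assume "interior (closure C') \<noteq> {}"
    then obtain w r where wr: "r > 0" "ball w r \<subseteq> C'"
      using clC by (auto simp: mem_interior)
    obtain v where "w < v" "v < w + r" "f v = k + 1" using level[of w "w + r" "k + 1"] wr by auto
    moreover from this have "v \<in> C'" using wr by (auto simp: dist_real_def)
    ultimately show False using fC by force
  qed
  ultimately have "cantor_set C'"
    using clC C(2) by (simp add: cantor_set_def perfect_set_def nowhere_dense_def C'_def)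
  moreover have "C' \<subseteq> open_segment x y"
  proof
    fix w assume "w \<in> C'"
    then have "\<bar>w - z\<bar> < e" using near by (auto simp: C'_def)
    then show "w \<in> open_segment x y"
      by (auto simp: e_def open_segment_eq_real_ivl abs_less_iff min_def max_def split: if_splits)
  qed
  moreover have "f ` C' \<subseteq> K" using fC k by auto
  moreover have "continuous_on C' f"
    using fC by (subst continuous_on_cong[OF refl, of _ _ "\<lambda>_. k"]) auto
  ultimately show "\<exists>C. cantor_set C \<and> C \<subseteq> open_segment x y \<and> f ` C \<subseteq> K \<and> continuous_on C f"
    by blast
qed

section \<open>A rational subspace with a perfect subset and large codimension\<close>

interpretation rat_vs: vector_space "\<lambda>(q::rat) (x::real). of_rat q * x"
  by unfold_locales (simp_all add: of_rat_add of_rat_mult algebra_simps)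

text \<open>The gaps \<open>2 * j + 1\<close> between consecutive exponents outgrow any bound on the
  digits. With weights \<open>(1/2) ^ j\<close> carries would be possible: the digits 1, -1, -1, ...
  sum to 0.\<close>

definition weight :: "nat \<Rightarrow> real" where
  "weight j = (1/2) ^ (j\<^sup>2)"

definition digit_sum :: "(nat \<Rightarrow> int) \<Rightarrow> real" where
  "digit_sum d = (\<Sum>j. of_int (d j) * weight j)"

lemma weight_pos: "weight j > 0"
  by (simp add: weight_def)

lemma weight_le: "weight j \<le> (1/2) ^ j"
  unfolding weight_def by (rule power_decreasing) (auto simp: power2_eq_square)

text \<open>\<open>2 * n + 1\<close> is the gap between the squares of \<open>n\<close> and
  \<open>n + 1\<close>; the factor \<open>(1/2) ^ j\<close> allows the tail to be summed as a
  geometric series.\<close>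

lemma weight_tail_le: "weight (j + Suc n) * 2 ^ (n\<^sup>2) \<le> (1/2) ^ (2 * n + 1) * (1/2) ^ j"
proof -
  have sq: "(j + Suc n)\<^sup>2 = n\<^sup>2 + ((2 * n + 1) + j + (j * j + j + 2 * n * j))"
    by (simp add: power2_eq_square algebra_simps)
  have "weight (j + Suc n) * 2 ^ (n\<^sup>2) = (1/2) ^ ((2 * n + 1) + j + (j * j + j + 2 * n * j))"
    unfolding weight_def sq by (subst power_add) (simp add: power_one_over)
  also have "\<dots> \<le> (1/2) ^ ((2 * n + 1) + j)"
    by (rule power_decreasing) auto
  finally show ?thesis by (simp add: power_add)
qed

lemma summable_weight: "summable weight"
proof (rule summable_comparison_test'[of "\<lambda>j. (1/2) ^ j" 0])
  show "summable (\<lambda>j. (1/2::real) ^ j)" by (rule summable_geometric) simp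
  show "norm (weight j) \<le> (1/2) ^ j" for j
    using weight_le[of j] weight_pos[of j] by simp
qed

lemma summable_bounded_digits:
  assumes "\<And>j. \<bar>d j\<bar> \<le> (N::real)"
  shows "summable (\<lambda>j. d j * weight j)"
proof (rule summable_comparison_test'[of "\<lambda>j. N * weight j" 0])
  show "summable (\<lambda>j. N * weight j)" by (intro summable_mult summable_weight)
  show "norm (d j * weight j) \<le> N * weight j" for j
    using assms[of j] weight_pos[of j] by (simp add: abs_mult)
qed

lemma summable_digits:
  assumes "\<And>j. \<bar>d j\<bar> \<le> (N::int)"
  shows "summable (\<lambda>j. of_int (d j) * weight j)"
  by (rule summable_bounded_digits[of _ "of_int N"]) (use assms in \<open>simp flip: of_int_abs\<close>)

lemma digit_sum_linear:
  assumes "\<And>j. \<bar>d j\<bar> \<le> N" "\<And>j. \<bar>d' j\<bar> \<le> N'"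
  shows "digit_sum (\<lambda>j. a * d j + b * d' j) = of_int a * digit_sum d + of_int b * digit_sum d'"
proof -
  have "(\<lambda>j. of_int a * (of_int (d j) * weight j) + of_int b * (of_int (d' j) * weight j)) sums
      (of_int a * digit_sum d + of_int b * digit_sum d')"
    unfolding digit_sum_def using summable_digits assms
    by (intro sums_add sums_mult summable_sums) blast+
  then show ?thesis
    unfolding digit_sum_def by (auto dest!: sums_unique simp: algebra_simps)
qed

text \<open>After scaling by \<open>2 ^ n\<^sup>2\<close> a partial sum is an integer while the remainder tends to \<open>0\<close>,
  so all late remainders vanish.\<close>

lemma digit_sum_eq_0_imp_eventually_0:
  assumes g: "\<And>j. \<bar>g j\<bar> \<le> N" and 0: "digit_sum g = 0"
  shows "\<exists>n0. \<forall>j>n0. g j = 0"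
proof -
  define a where "a j = of_int (g j) * weight j" for j
  define T where "T n = (\<Sum>j. a (j + n))" for n
  have sa: "summable a" unfolding a_def by (rule summable_digits[OF g])
  have split: "T n + (\<Sum>i<n. a i) = 0" for n
  proof -
    have "suminf a = 0" using 0 by (simp add: digit_sum_def a_def[abs_def])
    then show ?thesis using suminf_split_initial_segment[OF sa, of n] by (simp add: T_def)
  qed
  have int: "T (Suc n) * 2 ^ (n\<^sup>2) \<in> \<int>" for n
  proof -
    have "a i * 2 ^ (n\<^sup>2) \<in> \<int>" if "i < Suc n" for i
    proof -
      have "i\<^sup>2 \<le> n\<^sup>2" using that by (simp add: power2_nat_le_eq_le)
      then have "(2::real) ^ (n\<^sup>2) = 2 ^ (i\<^sup>2) * 2 ^ (n\<^sup>2 - i\<^sup>2)"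
        by (simp flip: power_add)
      then have "a i * 2 ^ (n\<^sup>2) = of_int (g i * 2 ^ (n\<^sup>2 - i\<^sup>2))"
        by (simp add: a_def weight_def power_one_over)
      then show ?thesis by (metis Ints_of_int)
    qed
    then have "(\<Sum>i<Suc n. a i * 2 ^ (n\<^sup>2)) \<in> \<int>"
      by (intro Ints_sum) (auto simp del: sum.lessThan_Suc)
    moreover have "T (Suc n) * 2 ^ (n\<^sup>2) = - (\<Sum>i<Suc n. a i * 2 ^ (n\<^sup>2))"
      using split[of "Suc n"] by (simp add: sum_distrib_right[symmetric] eq_neg_iff_add_eq_0 del: sum.lessThan_Suc flip: distrib_right)
    ultimately show ?thesis by (simp only: Ints_minus)
  qed
  have N: "N \<ge> 0" using g[of 0] by linarith
  have bound: "\<bar>T (Suc n) * 2 ^ (n\<^sup>2)\<bar> \<le> of_int N * (1/2) ^ (2 * n)" for n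
  proof -
    have sm: "(\<lambda>j. of_int N * ((1/2::real) ^ (2 * n + 1) * (1/2) ^ j)) sums (of_int N * ((1/2) ^ (2 * n + 1) * 2))"
      by (intro sums_mult) (use geometric_sums[of "1/2::real"] in simp)
    have le: "norm (a (j + Suc n) * 2 ^ (n\<^sup>2)) \<le> of_int N * ((1/2) ^ (2 * n + 1) * (1/2) ^ j)" for j
    proof -
      have "norm (a (j + Suc n) * 2 ^ (n\<^sup>2)) = \<bar>of_int (g (j + Suc n))\<bar> * (weight (j + Suc n) * 2 ^ (n\<^sup>2))"
        using weight_pos[of "j + Suc n"] by (simp add: a_def abs_mult)
      also have "\<dots> \<le> of_int N * ((1/2) ^ (2 * n + 1) * (1/2) ^ j)"
      proof (rule mult_mono[OF _ weight_tail_le])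
        show "\<bar>of_int (g (j + Suc n))\<bar> \<le> (of_int N :: real)"
          using g[of "j + Suc n"] by (simp flip: of_int_abs)
        show "0 \<le> weight (j + Suc n) * 2 ^ (n\<^sup>2)"
          using weight_pos[of "j + Suc n"] by simp
      qed (use N in simp)
      finally show ?thesis .
    qed
    have "T (Suc n) * 2 ^ (n\<^sup>2) = (\<Sum>j. a (j + Suc n) * 2 ^ (n\<^sup>2))"
      unfolding T_def by (intro suminf_mult2 summable_ignore_initial_segment sa)
    also have "\<bar>\<dots>\<bar> \<le> (\<Sum>j. of_int N * ((1/2) ^ (2 * n + 1) * (1/2) ^ j))"
      using norm_suminf_le[OF le sums_summable[OF sm]] by simp
    also have "\<dots> = of_int N * (1/2) ^ (2 * n)"
      using sums_unique[OF sm] by simp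
    finally show ?thesis .
  qed
  have "(\<lambda>n. of_int N * ((1/4::real) ^ n)) \<longlonglongrightarrow> of_int N * 0"
    by (intro tendsto_intros LIMSEQ_realpow_zero) auto
  then have "\<forall>\<^sub>F n in sequentially. of_int N * ((1/4::real) ^ n) < 1"
    by (rule order_tendstoD) simp
  then obtain n0 where n0: "\<And>n. n \<ge> n0 \<Longrightarrow> of_int N * ((1/4::real) ^ n) < 1"
    by (auto simp: eventually_sequentially)
  have T0: "T (Suc n) = 0" if "n \<ge> n0" for n
  proof -
    have "(1/2::real) ^ (2 * n) = (1/4) ^ n" by (simp add: power_mult power2_eq_square)
    then have "\<bar>T (Suc n) * 2 ^ (n\<^sup>2)\<bar> < 1" using bound[of n] n0[OF that] by simp
    then have "T (Suc n) * 2 ^ (n\<^sup>2) = 0" using int[of n] by (metis Ints_nonzero_abs_less1)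
    then show ?thesis by simp
  qed
  \<comment> \<open>Consecutive remainders differ by one term, which therefore vanishes.\<close>
  have "g j = 0" if j: "j > Suc n0" for j
  proof -
    obtain n where n: "j = Suc n" "n \<ge> Suc n0" using j by (cases j) auto
    have "T j = 0" "T (Suc j) = 0" using T0[of n] T0[of j] n by auto
    then have "a j = 0" using split[of j] split[of "Suc j"] by simp
    then show ?thesis using weight_pos[of j] by (simp add: a_def)
  qed
  then show ?thesis by blast
qed

text \<open>Even positions carry the subspace; odd ones are kept free to tell its cosets apart. The
  factor \<open>m\<close> clears denominators, and the bound \<open>N\<close> may depend on
  \<open>x\<close> because addition enlarges digits.\<close>

definition small_subspace :: "real set" where
  "small_subspace = {x. \<exists>m d N. m \<noteq> 0 \<and> (\<forall>j. \<bar>d j\<bar> \<le> N) \<and> (\<forall>j. odd j \<longrightarrow> d j = 0)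
     \<and> of_int m * x = digit_sum d}"

lemma small_subspaceI:
  assumes "m \<noteq> 0" "\<And>j. \<bar>d j\<bar> \<le> N" "\<And>j. odd j \<Longrightarrow> d j = 0" "of_int m * x = digit_sum d"
  shows "x \<in> small_subspace"
  using assms unfolding small_subspace_def by blast

lemma subspace_small_subspace: "rat_vs.subspace small_subspace"
  unfolding rat_vs.subspace_def
proof (intro conjI ballI allI)
  show "0 \<in> small_subspace"
    by (rule small_subspaceI[of 1 "\<lambda>_. 0" 0]) (auto simp: digit_sum_def)
  fix x assume "x \<in> small_subspace"
  then obtain m d N where x: "m \<noteq> 0" "\<And>j. \<bar>d j\<bar> \<le> N" "\<And>j. odd j \<Longrightarrow> d j = 0" "of_int m * x = digit_sum d"
    by (auto simp: small_subspace_def)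
  show "x + y \<in> small_subspace" if y0: "y \<in> small_subspace" for y
  proof -
    obtain m' d' N' where y: "m' \<noteq> 0" "\<And>j. \<bar>d' j\<bar> \<le> N'" "\<And>j. odd j \<Longrightarrow> d' j = 0" "of_int m' * y = digit_sum d'"
      using y0 by (auto simp: small_subspace_def)
    have "\<bar>m' * d j + m * d' j\<bar> \<le> \<bar>m'\<bar> * N + \<bar>m\<bar> * N'" for j
      by (intro order_trans[OF abs_triangle_ineq] add_mono) (use x y in \<open>auto simp: abs_mult mult_left_mono\<close>)
    moreover have "of_int (m * m') * (x + y) = digit_sum (\<lambda>j. m' * d j + m * d' j)"
      unfolding digit_sum_linear[OF x(2) y(2)] by (simp add: algebra_simps flip: x(4) y(4))
    ultimately show ?thesis
      using x y by (intro small_subspaceI[of "m * m'" "\<lambda>j. m' * d j + m * d' j" "\<bar>m'\<bar> * N + \<bar>m\<bar> * N'"]) auto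
  qed
  show "of_rat q * x \<in> small_subspace" for q
  proof -
    obtain u v where q: "q = Fract u v" "v > 0" by (cases q) auto
    then have v: "of_int v * (of_rat q * x) = of_int u * x"
      by (simp add: of_rat_rat)
    \<comment> \<open>The summand \<open>0 * d j\<close> puts a multiple into the shape treated by
      \<open>digit_sum_linear\<close>.\<close>
    have "\<bar>u * d j + 0 * d j\<bar> \<le> \<bar>u\<bar> * N" for j
      using x by (simp add: abs_mult mult_left_mono)
    moreover have "of_int (m * v) * (of_rat q * x) = of_int m * (of_int v * (of_rat q * x))"
      by simp
    then have "of_int (m * v) * (of_rat q * x) = of_int u * (of_int m * x)"
      by (simp only: v) simp
    then have "of_int (m * v) * (of_rat q * x) = digit_sum (\<lambda>j. u * d j + 0 * d j)"
      unfolding digit_sum_linear[OF x(2) x(2)] by (simp add: x(4))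
    ultimately show ?thesis
      by (intro small_subspaceI[of "m * v" "\<lambda>j. u * d j + 0 * d j" "\<bar>u\<bar> * N"]) (use x q in auto)
  qed
qed

text \<open>Pairing distributes the odd positions over the naturals, each natural receiving
  infinitely many. Different sets thus give digits that differ infinitely often, at positions where
  \<open>small_subspace\<close> has digit 0, whereas bounded digits with sum 0 are eventually
  0.\<close>

lemma small_subspace_large_codimension:
  obtains t :: "nat set \<Rightarrow> real" where "\<And>A B. A \<noteq> B \<Longrightarrow> t A - t B \<notin> small_subspace"
proof
  define dg :: "nat set \<Rightarrow> nat \<Rightarrow> int" where
    "dg A j = (if odd j \<and> fst (prod_decode (j div 2)) \<in> A then 1 else 0)" for A j
  have dg: "\<bar>dg A j\<bar> \<le> 1" for A j by (simp add: dg_def)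
  show "digit_sum (dg A) - digit_sum (dg B) \<notin> small_subspace" if AB: "A \<noteq> B" for A B
  proof
    assume "digit_sum (dg A) - digit_sum (dg B) \<in> small_subspace"
    then obtain m d N where x: "m \<noteq> 0" "\<And>j. \<bar>d j\<bar> \<le> N" "\<And>j. odd j \<Longrightarrow> d j = 0"
        "of_int m * (digit_sum (dg A) - digit_sum (dg B)) = digit_sum d"
      by (auto simp: small_subspace_def)
    define h where "h j = m * dg A j + (- m) * dg B j" for j
    define g where "g j = 1 * h j + (- 1) * d j" for j
    have h: "\<bar>h j\<bar> \<le> \<bar>m\<bar> + \<bar>m\<bar>" for j
      unfolding h_def by (intro order_trans[OF abs_triangle_ineq] add_mono) (use dg[of A j] dg[of B j] in \<open>auto simp: dg_def\<close>)
    have "\<bar>g j\<bar> \<le> (\<bar>m\<bar> + \<bar>m\<bar>) + N" for j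
      unfolding g_def by (intro order_trans[OF abs_triangle_ineq] add_mono) (use h[of j] x(2)[of j] in auto)
    moreover have "digit_sum g = 0"
      unfolding g_def digit_sum_linear[OF h x(2)] unfolding h_def digit_sum_linear[OF dg dg]
      using x(4) by (simp add: algebra_simps)
    ultimately obtain n0 where n0: "\<And>j. j > n0 \<Longrightarrow> g j = 0"
      using digit_sum_eq_0_imp_eventually_0 by blast
    obtain k where k: "(k \<in> A) \<noteq> (k \<in> B)" using AB by blast
    \<comment> \<open>A position belonging to \<open>k\<close> that lies beyond
      \<open>n0\<close>.\<close>
    define j where "j = 2 * prod_encode (k, n0) + 1"
    have "n0 \<le> prod_encode (k, n0)" by (rule le_prod_encode_2)
    then have "g j = 0" by (intro n0) (simp add: j_def)
    moreover have "j div 2 = prod_encode (k, n0)" "odd j" by (auto simp: j_def)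
    ultimately show False
      using k x(1) x(3)[of j] by (auto simp: g_def h_def dg_def split: if_splits)
  qed
qed

text \<open>The compact cube of 0-1 sequences is mapped continuously through its even digits.
  Flipping the digit at \<open>2 * k\<close> moves the image by exactly
  \<open>weight (2 * k)\<close>, which is nonzero and tends to 0.\<close>

lemma small_subspace_contains_perfect_compact:
  obtains C where "compact C" "C \<noteq> {}" "C \<subseteq> small_subspace" "\<And>x. x \<in> C \<Longrightarrow> \<not> x isolated_in C"
proof
  define K :: "(nat \<Rightarrow> real) set" where "K = {x. \<forall>j. x j \<in> {0, 1}}"
  define h where "h x = (\<Sum>j. (if even j then x j else 0) * weight j)" for x :: "nat \<Rightarrow> real"
  have bd: "\<bar>if even j then x j else 0\<bar> \<le> 1" if "x \<in> K" for x j
    using that[unfolded K_def, simplified, rule_format, of j] by auto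
  have summ: "summable (\<lambda>j. (if even j then x j else 0) * weight j)" if "x \<in> K" for x
    by (rule summable_bounded_digits[of _ 1]) (use bd[OF that] in auto)
  have "compactin (product_topology (\<lambda>i::nat. euclidean) UNIV) (PiE UNIV (\<lambda>i. {0, 1::real}))"
    by (simp add: compactin_PiE)
  moreover have "PiE UNIV (\<lambda>i. {0, 1::real}) = K" by (auto simp: K_def PiE_def Pi_def)
  ultimately have "compact K" by (simp add: euclidean_product_topology)
  moreover have "continuous_on K h"
  proof (rule uniform_limit_theorem)
    show "uniform_limit K (\<lambda>n x. \<Sum>j<n. (if even j then x j else 0) * weight j) h sequentially"
      unfolding h_def
    proof (rule Weierstrass_m_test)
      show "summable weight" by (rule summable_weight)
      show "norm ((if even j then x j else 0) * weight j) \<le> weight j" if "x \<in> K" for j x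
        using bd[OF that, of j] weight_pos[of j] by (simp add: abs_mult mult_le_cancel_right1)
    qed
    have "continuous_on K (\<lambda>x. (if even j then x j else 0) * weight j)" for j
      by (cases "even j") (auto intro!: continuous_intros continuous_on_product_coordinates continuous_on_subset[OF continuous_on_product_coordinates])
    then show "\<forall>\<^sub>F n in sequentially. continuous_on K (\<lambda>x. \<Sum>j<n. (if even j then x j else 0) * weight j)"
      by (intro always_eventually allI continuous_on_sum)
  qed simp
  ultimately show "compact (h ` K)" by (rule compact_continuous_image[rotated])
  have "(\<lambda>_. 0) \<in> K" by (simp add: K_def)
  then show "h ` K \<noteq> {}" by blast
  show "h ` K \<subseteq> small_subspace"
  proof
    fix y assume "y \<in> h ` K"
    then obtain x where x: "x \<in> K" "y = h x" by blast
    define d where "d j = (if even j then \<lfloor>x j\<rfloor> else 0)" for j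
    have d: "of_int (d j) = (if even j then x j else 0)" for j
      using x(1)[unfolded K_def, simplified, rule_format, of j] by (auto simp: d_def)
    show "y \<in> small_subspace"
    proof (rule small_subspaceI[of 1 d 1])
      show "\<bar>d j\<bar> \<le> 1" for j
        using x(1)[unfolded K_def, simplified, rule_format, of j] by (auto simp: d_def)
      show "of_int 1 * y = digit_sum d" by (simp add: digit_sum_def d x h_def)
    qed (auto simp: d_def)
  qed
  show "\<not> y isolated_in h ` K" if y: "y \<in> h ` K" for y
  proof
    assume "y isolated_in h ` K"
    then obtain e where e: "e > 0" "\<And>z. z \<in> h ` K \<Longrightarrow> dist y z < e \<Longrightarrow> z = y"
      by (auto simp: isolated_in_dist_Ex_iff)
    obtain x where x: "x \<in> K" "y = h x" using y by blast
    obtain k where "(1/2::real) ^ k < e" using e real_arch_pow_inv[of e "1/2"] by auto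
    moreover have "weight (2 * k) \<le> (1/2) ^ k"
      by (rule order_trans[OF weight_le power_decreasing]) auto
    ultimately have wk: "weight (2 * k) < e" by linarith
    define x' where "x' = x(2 * k := 1 - x (2 * k))"
    have x': "x' \<in> K" using x by (auto simp: x'_def K_def)
    have s1: "(\<lambda>j. (if even j then x' j else 0) * weight j - (if even j then x j else 0) * weight j)
        sums (h x' - h x)"
      unfolding h_def using summ[OF x'] summ[OF x(1)] by (intro sums_diff summable_sums)
    have s2: "(\<lambda>j. if j = 2 * k then (1 - 2 * x (2 * k)) * weight (2 * k) else 0)
        sums ((1 - 2 * x (2 * k)) * weight (2 * k))"
      using sums_single[of "2 * k" "\<lambda>j. (1 - 2 * x (2 * k)) * weight (2 * k)"] by simp
    have eq: "(\<lambda>j. (if even j then x' j else 0) * weight j - (if even j then x j else 0) * weight j)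
        = (\<lambda>j. if j = 2 * k then (1 - 2 * x (2 * k)) * weight (2 * k) else 0)"
      by (auto simp: x'_def fun_eq_iff algebra_simps)
    have "h x' - h x = (1 - 2 * x (2 * k)) * weight (2 * k)"
      using sums_unique2[OF s1[unfolded eq] s2] .
    moreover have "1 - 2 * x (2 * k) = 1 \<or> 1 - 2 * x (2 * k) = -1"
      using x(1)[unfolded K_def, simplified, rule_format, of "2 * k"] by auto
    ultimately have "\<bar>h x' - h x\<bar> = weight (2 * k)"
      using weight_pos[of "2 * k"] by auto
    then have "dist y (h x') < e" "h x' \<noteq> y" using wk x weight_pos[of "2 * k"] by (auto simp: dist_real_def)
    then show False using e x' by blast
  qed
qed

section \<open>The transfinite construction\<close>

text \<open>For large \<open>n\<close> the number \<open>x / (n + 1)\<close> is a difference of two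
  points of the interval, one of them the midpoint.\<close>

lemma interval_subset_subspace:
  assumes V: "rat_vs.subspace V" and cd: "c < d" "{c<..<d} \<subseteq> V"
  shows "V = UNIV"
proof -
  have "x \<in> V" for x
  proof -
    define m where "m = (c + d) / 2"
    have "0 < (d - c) / 2 / (\<bar>x\<bar> + 1)" using cd by simp
    then obtain n where "inverse (real (Suc n)) < (d - c) / 2 / (\<bar>x\<bar> + 1)"
      using reals_Archimedean by blast
    then have "(\<bar>x\<bar> + 1) / real (Suc n) < (d - c) / 2"
      by (simp add: field_simps add_pos_nonneg)
    moreover have "\<bar>x / real (Suc n)\<bar> \<le> (\<bar>x\<bar> + 1) / real (Suc n)"
      by (simp add: abs_divide divide_right_mono)
    ultimately have "\<bar>x / real (Suc n)\<bar> < (d - c) / 2" by linarith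
    then have "m + x / real (Suc n) \<in> {c<..<d}" "m \<in> {c<..<d}"
      using cd(1) by (auto simp: m_def abs_less_iff field_simps)
    then have "(m + x / real (Suc n)) - m \<in> V"
      using cd(2) V by (intro rat_vs.subspace_diff) auto
    then have "x / real (Suc n) \<in> V" by simp
    then have "of_rat (of_nat (Suc n)) * (x / real (Suc n)) \<in> V"
      by (rule rat_vs.subspace_scale[OF V])
    then show ?thesis by (simp only: of_rat_of_nat_eq) simp
  qed
  then show ?thesis by blast
qed

section \<open>Cardinalities of rational spans and of the family of closed sets\<close>

unbundle cardinal_syntax

text \<open>\<open>A n\<close> holds the combinations with \<open>n\<close> summands from
  \<open>S\<close>. The bounding set \<open>Y\<close> adjoins the naturals to \<open>S\<close>, so
  it is infinite and absorbs both the rational coefficients and the union over \<open>n\<close>; it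
  stays below \<open>U\<close> because \<open>U\<close> is uncountable.\<close>

lemma card_of_rat_span:
  fixes S :: "real set" and U :: "'i set"
  assumes U: "uncountable U" and S: "|S| <o |U|"
  shows "|rat_vs.span S| <o |U|"
proof -
  define Y where "Y = (UNIV :: nat set) <+> S"
  have infY: "infinite Y" by (simp add: Y_def)
  have "\<not> |U| \<le>o |UNIV :: nat set|"
    using U card_of_ordLeq[of U "UNIV :: nat set"] by (auto simp: countable_def)
  then have "|UNIV :: nat set| <o |U|"
    by (simp add: not_ordLeq_iff_ordLess[OF card_of_Well_order card_of_Well_order])
  then have Y: "|Y| <o |U|"
    unfolding Y_def using S U uncountable_infinite by (intro card_of_Plus_ordLess_infinite)
  define A where "A = rec_nat {0 :: real} (\<lambda>_ B. (\<lambda>((q, x), s). of_rat q * x + s) ` ((UNIV \<times> S) \<times> B))"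
  have A0: "A 0 = {0}" and ASuc: "A (Suc n) = (\<lambda>((q, x), s). of_rat q * x + s) ` ((UNIV \<times> S) \<times> A n)" for n
    by (simp_all add: A_def)
  have "|UNIV :: rat set| \<le>o |UNIV :: nat set|"
    using countableI_type[of "UNIV :: rat set"] card_of_ordLeq[of "UNIV :: rat set" "UNIV :: nat set"]
    by (auto simp: countable_def)
  then have ratY: "|UNIV :: rat set| \<le>o |Y|"
    unfolding Y_def using card_of_Plus1 ordLeq_transitive by blast
  have SY: "|S| \<le>o |Y|" unfolding Y_def by (rule card_of_Plus2)
  have An: "|A n| \<le>o |Y|" for n
  proof (induction n)
    case 0
    have "Y \<noteq> {}" using infY by auto
    then show ?case by (simp add: A0 card_of_singl_ordLeq)
  next
    case (Suc n)
    have "|((UNIV :: rat set) \<times> S) \<times> A n| \<le>o |Y|"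
      using infY ratY SY Suc by (intro card_of_Sigma_ordLeq_infinite ballI)
    then show ?case unfolding ASuc using card_of_image ordLeq_transitive by blast
  qed
  have natY: "|UNIV :: nat set| \<le>o |Y|" unfolding Y_def by (rule card_of_Plus1)
  have "rat_vs.span S \<subseteq> (\<Union>n. A n)"
  proof
    fix x assume "x \<in> rat_vs.span S"
    then show "x \<in> (\<Union>n. A n)"
    proof (induction rule: rat_vs.span_induct_alt)
      case base
      have "0 \<in> A 0" by (simp add: A0)
      then show ?case by blast
    next
      case (step c x y)
      then obtain n where "y \<in> A n" by blast
      then have "of_rat c * x + y \<in> A (Suc n)"
        unfolding ASuc using step(1) by (intro image_eqI[of _ _ "((c, x), y)"]) auto
      then show ?case by blast
    qed
  qed
  then have "|rat_vs.span S| \<le>o |\<Union>n. A n|" by (rule card_of_mono1)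
  moreover have "|\<Union>n. A n| \<le>o |Y|"
    using An by (intro card_of_UNION_ordLeq_infinite infY natY) auto
  ultimately show ?thesis
    using Y ordLeq_transitive ordLeq_ordLess_trans by blast
qed

text \<open>The complement of a closed set is a union of members of a countable base and is coded by
  their indices.\<close>

lemma closed_sets_indexed_by_nat_sets:
  "\<exists>e :: nat set \<Rightarrow> 'a::second_countable_topology set. \<forall>B. closed B \<longrightarrow> B \<in> range e"
proof -
  obtain \<B> :: "'a set set" where \<B>: "countable \<B>" "\<And>S. open S \<Longrightarrow> \<exists>U. U \<subseteq> \<B> \<and> S = \<Union>U"
    using univ_second_countable by metis
  define e where "e k = - \<Union> {C \<in> \<B>. to_nat_on \<B> C \<in> k}" for k
  have "B \<in> range e" if B: "closed B" for B
  proof -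
    obtain U where U: "U \<subseteq> \<B>" "- B = \<Union>U"
      using \<B>(2)[of "- B"] open_Compl[OF B] by blast
    have "{C \<in> \<B>. to_nat_on \<B> C \<in> to_nat_on \<B> ` U} = U"
      using U(1) inj_on_to_nat_on[OF \<B>(1)] by (auto dest: inj_onD)
    then have "e (to_nat_on \<B> ` U) = B"
      by (simp only: e_def flip: U(2)) simp
    then show ?thesis by blast
  qed
  then show ?thesis by blast
qed

text \<open>The index set carries a well-order of the least possible type, so that fewer than
  continuum many values have been fixed when an index is treated.\<close>

lemma exists_generic_additive:
  fixes W :: "real set" and t :: "nat set \<Rightarrow> real"
  assumes W: "rat_vs.subspace W" and t: "\<And>A B. A \<noteq> B \<Longrightarrow> t A - t B \<notin> W"
  obtains f :: "real \<Rightarrow> real"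
  where "Modules.additive f" "\<And>w. w \<in> W \<Longrightarrow> f w = 0"
    "\<And>B c d. closed B \<Longrightarrow> c < d \<Longrightarrow> {c<..<d} \<subseteq> fst ` B \<Longrightarrow> \<exists>x. (x, f x) \<in> B"
    "\<And>G c d. closed G \<Longrightarrow> G \<subseteq> graph_on f UNIV \<Longrightarrow> c < d \<Longrightarrow> \<not> {c<..<d} \<subseteq> snd ` G"
proof -
  define \<I> where "\<I> = (UNIV :: nat set set)"
  define r where "r = |\<I>|"
  define before where "before = underS r"
  have unc: "uncountable \<I>"
    unfolding \<I>_def using eqpoll_imp_lepoll[OF eqpoll_sym[OF nat_sets_eqpoll_reals]]
    by (metis countable_lepoll uncountable_UNIV_real)
  have small: "|before i| <o |\<I>|" for i
    unfolding before_def r_def by (rule card_of_underS[OF card_of_Card_order]) (simp add: Field_card_of \<I>_def)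
  have wo: "well_order_on UNIV r" unfolding r_def \<I>_def by (rule card_of_well_order_on)
  then have wf: "wf (r - Id)" by (simp add: well_order_on_def)
  have before: "j \<in> before i \<longleftrightarrow> (j, i) \<in> r - Id" for i j
    by (auto simp: before_def underS_def)
  have total: "j \<in> before i \<or> i \<in> before j" if "i \<noteq> j" for i j
    using wo that by (auto simp: before well_order_on_def linear_order_on_def total_on_def)
  have trans: "k \<in> before i" if "k \<in> before j" "j \<in> before i" for i j k
  proof -
    have "trans r" "antisym r"
      using wo by (auto simp: well_order_on_def linear_order_on_def partial_order_on_def preorder_on_def)
    then show ?thesis using that unfolding before by (auto dest: transD antisymD)
  qed
  obtain e :: "nat set \<Rightarrow> (real \<times> real) set" where e: "\<forall>B. closed B \<longrightarrow> B \<in> range e"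
    using closed_sets_indexed_by_nat_sets by (rule exE)
  \<comment> \<open>Element 0 of \<open>i\<close> is a flag and the rest codes a closed set. So each
    closed set occurs both as one to be met by the graph and as one to be kept, where possible, from
    lying inside it.\<close>
  define req where "req i = e {n. Suc n \<in> i}" for i
  have req: "\<exists>i. req i = B \<and> ((0 \<in> i) = p)" if B: "closed B" for B p
  proof -
    obtain k where k: "e k = B" using e B by blast
    define i where "i = Suc ` k \<union> (if p then {0} else {})"
    have "{n. Suc n \<in> i} = k" by (auto simp: i_def)
    moreover have "(0 \<in> i) = p" by (auto simp: i_def)
    ultimately show ?thesis using k by (auto simp: req_def)
  qed
  obtain B0 where B0: "B0 \<subseteq> W" "rat_vs.independent B0" "rat_vs.span B0 = W"
    using rat_vs.basis_exists[of W] rat_vs.span_subspace[OF _ _ W] by metis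
  \<comment> \<open>The abscissae at which \<open>B0\<close> and the earlier stages already
    determine \<open>f\<close>.\<close>
  define V where "V h i = rat_vs.span (B0 \<union> (fst \<circ> h) ` before i)" for h :: "nat set \<Rightarrow> real \<times> real" and i
  \<comment> \<open>The \<open>t A\<close> lie in distinct cosets of \<open>W\<close>. If they all
    belonged to \<open>V h i\<close>, their components \<open>s A\<close> would be continuum many
    elements in the span of fewer than continuum many reals.\<close>
  have Vproper: "V h i \<noteq> UNIV" for h i
  proof
    assume "V h i = UNIV"
    then have "\<exists>w s. w \<in> W \<and> s \<in> rat_vs.span ((fst \<circ> h) ` before i) \<and> t A = w + s" for A
    proof -
      have "t A \<in> V h i" using \<open>V h i = UNIV\<close> by simp
      then show ?thesis unfolding V_def rat_vs.span_Un B0(3) by blast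
    qed
    then obtain w s where ws: "\<And>A. w A \<in> W" "\<And>A. s A \<in> rat_vs.span ((fst \<circ> h) ` before i)"
        "\<And>A. t A = w A + s A"
      by metis
    have "inj s"
    proof (rule injI, rule ccontr)
      fix A B assume "s A = s B" "A \<noteq> B"
      then have "t A - t B = w A - w B" using ws(3) by simp
      then show False using t[OF \<open>A \<noteq> B\<close>] rat_vs.subspace_diff[OF W ws(1) ws(1)] by simp
    qed
    then have "|\<I>| \<le>o |rat_vs.span ((fst \<circ> h) ` before i)|"
      unfolding \<I>_def using ws(2) card_of_ordLeq by blast
    moreover have "|rat_vs.span ((fst \<circ> h) ` before i)| <o |\<I>|"
      using unc small[of i] card_of_image ordLeq_ordLess_trans by (intro card_of_rat_span) blast+
    ultimately show False using not_ordLess_ordLeq by blast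
  qed
  \<comment> \<open>If \<open>req i\<close> has a point over an undetermined abscissa, the new pair
    lies on the set or disagrees with one of its points over the same abscissa, depending on the
    flag. Otherwise only independence of the new abscissa is asked.\<close>
  define P where "P h i p \<longleftrightarrow> fst p \<notin> V h i \<and> (\<not> fst ` req i \<subseteq> V h i \<longrightarrow>
      (if 0 \<in> i then p \<in> req i else \<exists>u. (fst p, u) \<in> req i \<and> u \<noteq> snd p))"
    for h :: "nat set \<Rightarrow> real \<times> real" and i p
  have "\<exists>h. \<forall>i. P h i (h i)"
  proof (rule dependent_wf_choice[OF wf])
    show "P h i p = P h' i p" if hh: "\<And>j. (j, i) \<in> r - Id \<Longrightarrow> h j = h' j" for h h' i p
    proof -
      have "(fst \<circ> h) ` before i = (fst \<circ> h') ` before i"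
        using hh by (intro image_cong) (auto simp: before)
      then show ?thesis by (simp add: P_def V_def)
    qed
    show "\<exists>p. P h i p" for h i
    proof (cases "fst ` req i \<subseteq> V h i")
      case True
      obtain x where "x \<notin> V h i" using Vproper[of h i] by blast
      then show ?thesis using True by (intro exI[of _ "(x, 0)"]) (simp add: P_def)
    next
      case False
      then obtain x u where "(x, u) \<in> req i" "x \<notin> V h i" by force
      then show ?thesis
        by (intro exI[of _ "(x, if 0 \<in> i then u else u + 1)"]) (auto simp: P_def)
    qed
  qed
  then obtain h where h: "\<And>i. P h i (h i)" by blast
  define x where "x i = fst (h i)" for i
  define v where "v i = snd (h i)" for i
  have V: "V h i = rat_vs.span (B0 \<union> x ` before i)" for i
    by (simp add: V_def x_def[abs_def] comp_def)
  have xV: "x i \<notin> V h i" for i using h[of i] by (simp add: P_def x_def)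
  have injx: "inj x"
  proof (rule injI, rule ccontr)
    fix i j assume ij: "x i = x j" "i \<noteq> j"
    have "x i \<in> V h j" if "i \<in> before j" for i j
      using that unfolding V by (intro rat_vs.span_base) auto
    then show False using total[OF ij(2)] ij(1) xV by metis
  qed
  have xB0: "x i \<notin> B0" for i
    using xV[of i] rat_vs.span_base[of "x i"] unfolding V by blast
  \<comment> \<open>The stages, ordered by inclusion. \<open>B0\<close> is added so that the union
    is correct for empty \<open>I\<close> as well.\<close>
  define chain where "chain I = insert B0 ((\<lambda>j. insert (x j) (B0 \<union> x ` before j)) ` I)" for I
  have ind_chain: "rat_vs.independent (\<Union> (chain I))"
    if I: "\<And>j. j \<in> I \<Longrightarrow> rat_vs.independent (B0 \<union> x ` before j)" for I
  proof (rule rat_vs.independent_Union_directed)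
    have sub: "insert (x j) (B0 \<union> x ` before j) \<subseteq> insert (x k) (B0 \<union> x ` before k)"
      if "j \<in> before k" for j k
      using that trans by auto
    show "C \<subseteq> C' \<or> C' \<subseteq> C" if CC: "C \<in> chain I" "C' \<in> chain I" for C C'
    proof (cases "C = B0 \<or> C' = B0")
      case True
      then show ?thesis using CC by (auto simp: chain_def)
    next
      case False
      then obtain j k where jk: "C = insert (x j) (B0 \<union> x ` before j)" "C' = insert (x k) (B0 \<union> x ` before k)"
        using CC by (auto simp: chain_def)
      show ?thesis
      proof (cases "j = k")
        case False
        then show ?thesis using total[of j k] sub[of j k] sub[of k j] jk by blast
      qed (simp add: jk)
    qed
    show "rat_vs.independent C" if C: "C \<in> chain I" for C
    proof (cases "C = B0")
      case False
      then obtain j where j: "j \<in> I" "C = insert (x j) (B0 \<union> x ` before j)"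
        using C by (auto simp: chain_def)
      then show ?thesis
        using I[of j] xV[of j] unfolding V by (simp add: rat_vs.independent_insertI)
    qed (simp add: B0)
  qed
  have ind: "rat_vs.independent (B0 \<union> x ` before i)" for i
    using wf
  proof (induction i rule: wf_induct_rule)
    case (less i)
    have "\<Union> (chain (before i)) = B0 \<union> x ` before i"
      using trans by (auto simp: chain_def)
    then show ?case
      using ind_chain[of "before i"] less by (simp add: before)
  qed
  then have "rat_vs.independent (\<Union> (chain UNIV))" by (rule ind_chain)
  moreover have "B0 \<union> range x \<subseteq> \<Union> (chain UNIV)"
    by (auto simp: chain_def)
  ultimately have indep: "rat_vs.independent (B0 \<union> range x)"
    by (rule rat_vs.independent_mono)
  interpret pair: vector_space_pair "\<lambda>(q::rat) (x::real). of_rat q * x" "\<lambda>(q::rat) (x::real). of_rat q * x"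
    by unfold_locales
  obtain f where lin: "Vector_Spaces.linear (\<lambda>(q::rat) (x::real). of_rat q * x) (\<lambda>(q::rat) (x::real). of_rat q * x) f"
      and fB: "\<And>z. z \<in> B0 \<union> range x \<Longrightarrow> f z = (if z \<in> range x then v (inv x z) else 0)"
    using pair.linear_independent_extend[OF indep, of "\<lambda>z. if z \<in> range x then v (inv x z) else 0"] by metis
  interpret f: Vector_Spaces.linear "\<lambda>(q::rat) (x::real). of_rat q * x" "\<lambda>(q::rat) (x::real). of_rat q * x" f
    by (rule lin)
  have fx: "f (x i) = v i" for i using fB[of "x i"] injx by simp
  have f0: "f z = 0" if "z \<in> B0" for z using fB[of z] that xB0 by auto
  have fspan: "f ` rat_vs.span S = rat_vs.span (f ` S)" for S
    by (simp add: f.span_image)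
  show ?thesis
  proof (rule that)
    show "Modules.additive f" by (rule additive.intro) (rule f.add)
    show "f w = 0" if "w \<in> W" for w
    proof -
      have "f w \<in> rat_vs.span (f ` B0)" using that B0(3) fspan by blast
      also have "f ` B0 \<subseteq> {0}" using f0 by auto
      then have "rat_vs.span (f ` B0) \<subseteq> rat_vs.span {0}" by (rule rat_vs.span_mono)
      finally show ?thesis by simp
    qed
    show "\<exists>z. (z, f z) \<in> B" if B: "closed B" "c < d" "{c<..<d} \<subseteq> fst ` B" for B c d
    proof -
      obtain i where i: "req i = B" "0 \<in> i" using req[OF B(1), of True] by blast
      \<comment> \<open>A proper subspace contains no interval, so stage \<open>i\<close> had a free
        abscissa and put a point of \<open>B\<close> on the graph.\<close>
      have "\<not> fst ` req i \<subseteq> V h i"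
        using interval_subset_subspace[of "V h i" c d] Vproper[of h i] B i(1)
        by (auto simp: V rat_vs.subspace_span)
      then have "h i \<in> B" using h[of i] i by (simp add: P_def)
      then show ?thesis using fx[of i] by (metis prod.collapse v_def x_def)
    qed
    show "\<not> {c<..<d} \<subseteq> snd ` G" if G: "closed G" "G \<subseteq> graph_on f UNIV" "c < d" for G c d
    proof
      assume cd: "{c<..<d} \<subseteq> snd ` G"
      obtain i where i: "req i = G" "0 \<notin> i" using req[OF G(1), of False] by blast
      \<comment> \<open>Had stage \<open>i\<close> found a free abscissa, the graph would disagree
        with \<open>G\<close> there.\<close>
      have "fst ` G \<subseteq> V h i"
      proof (rule ccontr)
        assume "\<not> fst ` G \<subseteq> V h i"
        then obtain u where "(x i, u) \<in> G" "u \<noteq> v i"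
          using h[of i] i by (auto simp: P_def x_def v_def)
        then show False using G(2) fx[of i] by (auto simp: graph_on_def)
      qed
      moreover have "snd ` G \<subseteq> f ` (fst ` G)"
        using G(2) by (force simp: graph_on_def)
      ultimately have "snd ` G \<subseteq> rat_vs.span (f ` (B0 \<union> x ` before i))"
        unfolding fspan[symmetric] V by blast
      then have sp: "rat_vs.span (f ` (B0 \<union> x ` before i)) = UNIV"
        using interval_subset_subspace[OF rat_vs.subspace_span \<open>c < d\<close>] cd by blast
      \<comment> \<open>\<open>B0\<close> is sent to 0, so all values come from the fewer than
        continuum many \<open>v j\<close> of earlier stages.\<close>
      have "f ` (B0 \<union> x ` before i) \<subseteq> rat_vs.span (v ` before i)"
        using f0 fx by (auto intro: rat_vs.span_base simp: rat_vs.span_zero)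
      then have "rat_vs.span (f ` (B0 \<union> x ` before i)) \<subseteq> rat_vs.span (v ` before i)"
        by (intro rat_vs.span_minimal rat_vs.subspace_span)
      then have "rat_vs.span (v ` before i) = UNIV" using sp by blast
      then have "|UNIV :: real set| <o |\<I>|"
        using card_of_rat_span[OF unc, of "v ` before i"] small[of i] card_of_image ordLeq_ordLess_trans
        by metis
      \<comment> \<open>The same \<open>t\<close> shows that there are at least as many reals as
        indices.\<close>
      moreover have "inj t"
        using t rat_vs.subspace_0[OF W] by (metis diff_self injI)
      then have "|\<I>| \<le>o |UNIV :: real set|"
        unfolding \<I>_def using card_of_ordLeq by blast
      ultimately show False using not_ordLess_ordLeq by blast
    qed
  qed
qed

theorem theorem3p2:
  shows "\<exists>f :: real \<Rightarrow> real.
           Modules.additive f \<and> almost_continuous f \<and> scivp f \<and> \<not> extendable f"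
proof -
  obtain C where C: "compact C" "C \<noteq> {}" "C \<subseteq> small_subspace" "\<And>x. x \<in> C \<Longrightarrow> \<not> x isolated_in C"
    using small_subspace_contains_perfect_compact by metis
  obtain t :: "nat set \<Rightarrow> real" where t: "\<And>A B. A \<noteq> B \<Longrightarrow> t A - t B \<notin> small_subspace"
    using small_subspace_large_codimension by metis
  show ?thesis
  proof (rule exists_generic_additive[OF subspace_small_subspace t])
    fix f :: "real \<Rightarrow> real"
    assume f: "Modules.additive f" "\<And>w. w \<in> small_subspace \<Longrightarrow> f w = 0"
      and meets: "\<And>B c d. closed B \<Longrightarrow> c < d \<Longrightarrow> {c<..<d} \<subseteq> fst ` B \<Longrightarrow> \<exists>x. (x, f x) \<in> B"
      and omits: "\<And>G c d. closed G \<Longrightarrow> G \<subseteq> graph_on f UNIV \<Longrightarrow> c < d \<Longrightarrow> \<not> {c<..<d} \<subseteq> snd ` G"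
    have ker: "f (c / real (Suc n)) = 0" if "c \<in> C" for c n
    proof -
      have "of_rat (1 / of_nat (Suc n)) * c \<in> small_subspace"
        using that C(3) by (intro rat_vs.subspace_scale subspace_small_subspace) auto
      moreover have "of_rat (1 / of_nat (Suc n)) * c = c / real (Suc n)"
        by (simp only: of_rat_divide of_rat_of_nat_eq of_rat_1) simp
      ultimately show ?thesis using f(2) by simp
    qed
    have "scivp f"
    proof (rule scivpI[OF f(1) _ C(1,2)])
      show "\<exists>x. (x, f x) \<in> B" if "closed B" "c < d" "{c<..<d} \<subseteq> fst ` B" for B c d
        using meets that .
      show "\<not> x isolated_in C" if "x \<in> C" for x
        using C(4) that .
      show "f (c / real (Suc n)) = 0" if "c \<in> C" for c n
        using ker that .
    qed
    moreover have "almost_continuous f"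
      by (rule almost_continuousI) (rule meets)
    moreover have "\<not> extendable f"
    proof
      assume ext: "extendable f"
      \<comment> \<open>The closed set in the graph requires an increase of \<open>f\<close>.
        Additivity gives \<open>f 0 = 0\<close>, and the graph meets the horizontal segment at
        height 1.\<close>
      have "\<exists>x. (x, f x) \<in> {0..1} \<times> {1}"
        by (rule meets[of _ 0 1]) (auto intro: closed_Times)
      then obtain x where x: "0 \<le> x" "f x = 1" by auto
      have "f 0 = 0" using additive.zero[OF f(1)] .
      then have "0 < x" "f 0 < f x" using x by (auto simp: less_le)
      then show False
        using extendable_graph_contains_closed_set[OF ext] omits by blast
    qed
    ultimately show ?thesis using f(1) by blast
  qed
qed

end
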